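(* Let $C\subset\mathbb{R}^2$ be a strictly convex body. Then for every finite set $S\subset\mathbb{R}^2$, \[f(C,2,S)\le |S|-\left\lceil\tfrac13(|S|-8)\right\rceil.\]
   Context: A convex body is a convex compact set with nonempty interior; it is strictly convex if its boundary contains no segment of positive length. A homothet of $C$ is $\lambda C+x$ with $\lambda>0$, $x\in\mathbb{R}^2$. $f(C,2,S)$ is the least number of homothets of $C$, each containing at most $2$ points of $S$, whose union covers $S$. *)

theory Defs
  imports "HOL-Analysis.Analysis"
begin

definition convex_body :: "(real^2) set \<Rightarrow> bool" where
  "convex_body C \<longleftrightarrow> convex C \<and> compact C \<and> interior C \<noteq> {}"

definition strictly_convex_body :: "(real^2) set \<Rightarrow> bool" where
  "strictly_convex_body C \<longleftrightarrow> convex_body C \<and>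
     (\<forall>a b. a \<noteq> b \<longrightarrow> \<not> closed_segment a b \<subseteq> frontier C)"

definition homothet :: "(real^2) set \<Rightarrow> real \<Rightarrow> real^2 \<Rightarrow> (real^2) set" where
  "homothet C l x = (\<lambda>y. l *\<^sub>R y + x) ` C"

definition is_homothet_of :: "(real^2) set \<Rightarrow> (real^2) set \<Rightarrow> bool" where
  "is_homothet_of C H \<longleftrightarrow> (\<exists>l x. l > 0 \<and> H = homothet C l x)"

definition f_cover :: "(real^2) set \<Rightarrow> nat \<Rightarrow> (real^2) set \<Rightarrow> nat" where
  "f_cover C k S = (LEAST n. \<exists>F. finite F \<and> card F = n \<and>
      (\<forall>H\<in>F. is_homothet_of C H \<and> card (H \<inter> S) \<le> k) \<and> S \<subseteq> \<Union>F)"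

end

theory Submission
  imports Defs
begin

text \<open>
  Join two points of \<open>S\<close> if some homothet of \<open>C\<close> contains exactly these two points of \<open>S\<close>; a matching
  with \<open>m\<close> edges gives \<open>f(C,2,S) \<le> |S| - m\<close>, so it suffices to find one with \<open>|S| \<le> 3 m + 8\<close>.
  Gallai's lemma provides a matching of some size \<open>m\<close>, a set \<open>T\<close> with \<open>|T| \<le> m\<close> and \<open>|S| - 2 m + |T|\<close> points
  \<open>W\<close> in pairwise different components of the graph without \<open>T\<close>. The points of \<open>S\<close> in any homothet induce
  a connected subgraph, so a homothet that misses \<open>T\<close> contains at most one point of \<open>W\<close>.

  It remains to show \<open>|W| \<le> 2 |T| + 8\<close>. Four far away points, placed in directions that illuminate the
  boundary of \<open>C\<close>, are added to \<open>T\<close>. Then every \<open>w \<in> W\<close> is interior to a homothet whose interior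
  misses \<open>T\<close> and which has three points of \<open>T\<close> on its boundary. Of these three let \<open>b\<close> be the one with
  the middle abscissa; the triangle lies locally above or below \<open>b\<close>. As two such triangles cannot overlap,
  \<open>b\<close> and the side determine the homothet and hence \<open>w\<close>.

  Homothets are written \<open>{x. l x + y \<in> C}\<close> with \<open>l > 0\<close>, i.e. \<open>l\<close> is the inverse of the ratio.
\<close>

section \<open>Maximum matchings\<close>

definition matching :: "'a set set \<Rightarrow> 'a set set \<Rightarrow> bool" where
  "matching E M \<longleftrightarrow> M \<subseteq> E \<and> disjoint M"

lemma matching_Union_card:
  assumes "matching E M" "finite M" "\<And>e. e \<in> E \<Longrightarrow> card e = 2"
  shows "card (\<Union>M) = 2 * card M"
proof -
  have "card (\<Union>M) = sum card M"
    using assms by (intro card_Union_disjoint) (auto simp: matching_def dest!: subsetD intro: card_ge_0_finite)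
  also have "\<dots> = sum (\<lambda>_. 2) M" using assms by (intro sum.cong) (auto simp: matching_def)
  finally show ?thesis by simp
qed

lemma matching_insert:
  assumes "matching E M" "e \<in> E" "e \<inter> \<Union>M = {}"
  shows "matching E (insert e M)"
  using assms by (auto simp: matching_def disjoint_def pairwise_def disjnt_def)

lemma matching_subset: "matching E M \<Longrightarrow> N \<subseteq> M \<Longrightarrow> matching E N"
  unfolding matching_def by (meson order_trans pairwise_subset)

lemma matching_mono: "matching E M \<Longrightarrow> E \<subseteq> E' \<Longrightarrow> matching E' M"
  by (auto simp: matching_def)

lemma matching_same_edge: "matching E M \<Longrightarrow> e \<in> M \<Longrightarrow> f \<in> M \<Longrightarrow> x \<in> e \<Longrightarrow> x \<in> f \<Longrightarrow> e = f"
  by (auto simp: matching_def disjoint_def pairwise_def disjnt_def)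

text \<open>The exchange step of Gallai's lemma. Among the maximum matchings that miss
  \<open>t\<close>, take \<open>X\<close> with the largest overlap with \<open>M\<close>. Both cover
  \<open>2 * m\<close> vertices and \<open>X\<close> covers \<open>u\<close> and \<open>v\<close>,
  so \<open>M\<close> covers at least two vertices that \<open>X\<close> misses, and one of them,
  \<open>x\<close>, is not \<open>t\<close>. The edge \<open>e = {x, y}\<close> of \<open>M\<close>
  meets \<open>X\<close> in \<open>y\<close> by maximality. Exchanging the \<open>X\<close>-edge at
  \<open>y\<close> for \<open>e\<close> still misses \<open>t\<close> but enlarges the overlap, a
  contradiction.\<close>

lemma gallai_swap:
  assumes fin: "finite E" and E2: "\<And>e. e \<in> E \<Longrightarrow> card e = 2"
    and max: "\<And>M. matching E M \<Longrightarrow> card M \<le> m"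
    and M: "matching E M" "card M = m" "u \<notin> \<Union>M" "v \<notin> \<Union>M" "u \<noteq> v"
    and N: "matching E N" "card N = m" "t \<notin> \<Union>N"
    and cov: "\<And>N. matching E N \<Longrightarrow> card N = m \<Longrightarrow> t \<notin> \<Union>N \<Longrightarrow> u \<in> \<Union>N \<and> v \<in> \<Union>N"
  shows False
proof -
  define P where "P N \<longleftrightarrow> matching E N \<and> card N = m \<and> t \<notin> \<Union>N" for N
  have finM: "finite X" if "matching E X" for X
    using that fin by (auto simp: matching_def intro: finite_subset)
  have bd: "card (M \<inter> X) < Suc (card M)" for X
    using finM[OF M(1)] by (simp add: card_mono less_Suc_eq_le)
  have "\<exists>X. P X \<and> (\<forall>Y. P Y \<longrightarrow> card (M \<inter> Y) \<le> card (M \<inter> X))"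
    by (rule ex_has_greatest_nat[of P N]) (use N bd in \<open>auto simp: P_def\<close>)
  then obtain X where X: "P X" and Xmax: "\<And>Y. P Y \<Longrightarrow> card (M \<inter> Y) \<le> card (M \<inter> X)" by blast
  have mX: "matching E X" "card X = m" "t \<notin> \<Union>X" using X by (auto simp: P_def)
  have uv: "u \<in> \<Union>X" "v \<in> \<Union>X" using cov[OF mX] by auto
  have cM: "card (\<Union>M) = 2 * m" using matching_Union_card[OF M(1) finM[OF M(1)] E2] M by simp
  have cX: "card (\<Union>X) = 2 * m" using matching_Union_card[OF mX(1) finM[OF mX(1)] E2] mX by simp
  have fe: "finite e" if "e \<in> E" for e using E2[OF that] by (metis card.infinite zero_neq_numeral)
  have fU: "finite (\<Union>M)" "finite (\<Union>X)"
    using finite_Union[OF finM[OF M(1)]] finite_Union[OF finM[OF mX(1)]] M(1) mX(1) fe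
    unfolding matching_def by (meson subsetD)+
  have "card (\<Union>X - \<Union>M) \<ge> card {u, v}"
    using uv M fU by (intro card_mono) auto
  moreover have "card (\<Union>X - \<Union>M) + card (\<Union>X \<inter> \<Union>M) = 2 * m"
    using card_Diff_subset_Int[of "\<Union>X" "\<Union>M"] fU cX card_mono[OF fU(2), of "\<Union>X \<inter> \<Union>M"] by force
  moreover have "card (\<Union>M - \<Union>X) + card (\<Union>X \<inter> \<Union>M) = 2 * m"
    using card_Diff_subset_Int[of "\<Union>M" "\<Union>X"] fU cM card_mono[OF fU(1), of "\<Union>M \<inter> \<Union>X"]
    by (simp add: Int_commute)
  ultimately have "card (\<Union>M - \<Union>X) \<ge> 2" using M(5) by simp
  then have "\<not> \<Union>M - \<Union>X \<subseteq> {t}"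
    using card_mono[of "{t}" "\<Union>M - \<Union>X"] by auto
  then obtain x where x: "x \<in> \<Union>M" "x \<notin> \<Union>X" "x \<noteq> t" by blast
  then obtain e where e: "e \<in> M" "x \<in> e" by blast
  have eE: "e \<in> E" using e M(1) by (auto simp: matching_def)
  obtain y where y: "e = {x, y}" "x \<noteq> y" using E2[OF eE] e(2) by (auto simp: card_2_iff)
  have "y \<in> \<Union>X"
  proof (rule ccontr)
    assume "y \<notin> \<Union>X"
    then have "e \<inter> \<Union>X = {}" using y x by auto
    then have "matching E (insert e X)" "e \<notin> X" using matching_insert[OF mX(1) eE] e by auto
    then show False using max[of "insert e X"] mX finM[OF mX(1)] by simp
  qed
  then obtain f where f: "f \<in> X" "y \<in> f" by blast
  have fM: "f \<notin> M" using matching_same_edge[OF M(1) e(1), of f y] y f x by blast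
  let ?Y = "insert e (X - {f})"
  have "e \<inter> \<Union>(X - {f}) = {}"
    using y x f matching_same_edge[OF mX(1) f(1)] by auto
  then have mY: "matching E ?Y" by (rule matching_insert[OF matching_subset[OF mX(1) Diff_subset] eE])
  have eX: "e \<notin> X" using x e by auto
  have "card ?Y = Suc (card (X - {f}))"
    using finM[OF mX(1)] eX by (intro card_insert_disjoint) auto
  then have "card ?Y = m" using card_Suc_Diff1[OF finM[OF mX(1)] f(1)] mX(2) by simp
  moreover have "t \<notin> \<Union>?Y" using mX(3) y x \<open>y \<in> \<Union>X\<close> by auto
  ultimately have "P ?Y" using mY by (auto simp: P_def)
  then have "card (M \<inter> ?Y) \<le> card (M \<inter> X)" by (rule Xmax)
  moreover have "M \<inter> ?Y = insert e (M \<inter> X)" using fM e by auto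
  ultimately show False using eX finM[OF M(1)] by simp
qed

text \<open>Induction on the number of vertices. If some \<open>v\<close> is covered by every
  maximum matching, delete it, apply the induction hypothesis and put \<open>v\<close> into
  \<open>T\<close>. Otherwise every vertex is missed by some maximum matching, and
  \<open>T = {}\<close> works with the uncovered vertices as \<open>W\<close>: by the exchange step,
  no two of them lie in the same component.\<close>

theorem gallai_separation:
  fixes V :: "'a set"
  assumes "finite V" "\<And>e. e \<in> E \<Longrightarrow> e \<subseteq> V \<and> card e = 2"
  shows "\<exists>M T W. matching E M \<and> T \<subseteq> V \<and> W \<subseteq> V - T \<and> card T \<le> card M \<and>
    card W + 2 * card M = card V + card T \<and>
    (\<forall>w\<in>W. \<forall>w'\<in>W. w \<noteq> w' \<longrightarrow> (\<exists>A \<subseteq> V - T. w \<in> A \<and> w' \<notin> A \<and>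
        (\<forall>x\<in>A. \<forall>y\<in>V - T - A. {x, y} \<notin> E)))"
  using assms
proof (induction "card V" arbitrary: V E rule: less_induct)
  case less
  have finE: "finite E" using less.prems by (intro finite_subset[of E "Pow V"]) auto
  have finM: "finite X" if "matching E X" for X
    using that finE by (auto simp: matching_def intro: finite_subset)
  have bd: "card X < Suc (card E)" if "matching E X" for X
    using finE that by (auto simp: matching_def less_Suc_eq_le intro: card_mono)
  have "matching E {}" by (simp add: matching_def)
  then have "\<exists>X. matching E X \<and> (\<forall>Y. matching E Y \<longrightarrow> card Y \<le> card X)"
    using bd by (intro ex_has_greatest_nat[of "matching E" "{}"]) auto
  then obtain M where M: "matching E M" and Mmax: "\<And>Y. matching E Y \<Longrightarrow> card Y \<le> card M" by blast
  show ?case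
  proof (cases "\<exists>v\<in>V. \<forall>N. matching E N \<and> card N = card M \<longrightarrow> v \<in> \<Union>N")
    case True
    then obtain v where v: "v \<in> V" and cov: "\<And>N. matching E N \<Longrightarrow> card N = card M \<Longrightarrow> v \<in> \<Union>N" by blast
    let ?E = "{e \<in> E. v \<notin> e}"
    have "card (V - {v}) < card V" using v less.prems(1) by (rule card_Diff1_less[rotated])
    moreover have "finite (V - {v})" using less.prems(1) by simp
    moreover have "e \<subseteq> V - {v} \<and> card e = 2" if "e \<in> ?E" for e using less.prems(2) that by auto
    ultimately obtain N T W where N: "matching ?E N" and T: "T \<subseteq> V - {v}" and W: "W \<subseteq> V - {v} - T"
      and TN: "card T \<le> card N" and eq: "card W + 2 * card N = card (V - {v}) + card T"
      and sep: "\<forall>w\<in>W. \<forall>w'\<in>W. w \<noteq> w' \<longrightarrow> (\<exists>A \<subseteq> V - {v} - T. w \<in> A \<and> w' \<notin> A \<and>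
        (\<forall>x\<in>A. \<forall>y\<in>V - {v} - T - A. {x, y} \<notin> ?E))"
      using less.hyps[of "V - {v}" ?E] by blast
    have NE: "matching E N" using N by (rule matching_mono) auto
    have "v \<notin> \<Union>N" using N by (auto simp: matching_def)
    \<comment> \<open>\<open>N\<close> misses \<open>v\<close>, so it is not maximum in the full
      graph. One more edge is therefore available, which pays for the new element of
      \<open>T\<close>.\<close>
    then have "card N < card M" using Mmax[OF NE] cov[OF NE] by fastforce
    \<comment> \<open>Exactly one edge more than \<open>N\<close>, not all of \<open>M\<close>: the
      count of \<open>W\<close> is an equation, and both of its sides then grow by 2.\<close>
    then obtain L where L: "L \<subseteq> M" "card L = Suc (card N)"
      by (meson Suc_leI obtain_subset_with_card_n)
    have VT: "V - insert v T = V - {v} - T" by auto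
    have cV: "card V = Suc (card (V - {v}))" using v less.prems(1) by (metis card.remove)
    have cT: "card (insert v T) = Suc (card T)"
      using T less.prems(1) by (subst card_insert_disjoint) (auto intro: finite_subset)
    show ?thesis
    proof (intro exI conjI)
      show "matching E L" using M L matching_subset by blast
      show "insert v T \<subseteq> V" using v T by auto
      show "W \<subseteq> V - insert v T" using W by auto
      show "card (insert v T) \<le> card L" using cT L TN by simp
      show "card W + 2 * card L = card V + card (insert v T)" using cT L eq cV by simp
      show "\<forall>w\<in>W. \<forall>w'\<in>W. w \<noteq> w' \<longrightarrow> (\<exists>A \<subseteq> V - insert v T. w \<in> A \<and> w' \<notin> A \<and>
        (\<forall>x\<in>A. \<forall>y\<in>V - insert v T - A. {x, y} \<notin> E))"
      proof (intro ballI impI)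
        fix w w' assume "w \<in> W" "w' \<in> W" "w \<noteq> w'"
        then obtain A where A: "A \<subseteq> V - {v} - T" "w \<in> A" "w' \<notin> A"
          "\<forall>x\<in>A. \<forall>y\<in>V - {v} - T - A. {x, y} \<notin> ?E" using sep by meson
        show "\<exists>A \<subseteq> V - insert v T. w \<in> A \<and> w' \<notin> A \<and> (\<forall>x\<in>A. \<forall>y\<in>V - insert v T - A. {x, y} \<notin> E)"
          unfolding VT using A by (intro exI[of _ A]) blast
      qed
    qed
  next
    case False
    then have miss: "\<exists>N. matching E N \<and> card N = card M \<and> v \<notin> \<Union>N" if "v \<in> V" for v using that by blast
    let ?W = "V - \<Union>M"
    have UM: "\<Union>M \<subseteq> V" using M less.prems(2) by (auto simp: matching_def)
    have cW: "card ?W + 2 * card M = card V"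
      using matching_Union_card[OF M finM[OF M]] less.prems(2) UM
        card_Diff_subset[OF finite_subset[OF UM less.prems(1)] UM] card_mono[OF less.prems(1) UM] by auto
    have sep: "\<exists>A \<subseteq> V. w \<in> A \<and> w' \<notin> A \<and> (\<forall>x\<in>A. \<forall>y\<in>V - A. {x, y} \<notin> E)"
      if w: "w \<in> ?W" "w' \<in> ?W" "w \<noteq> w'" for w w'
    proof -
      \<comment> \<open>Besides \<open>w\<close>, the set holds the vertices that no maximum
        matching misses together with \<open>w\<close>. The end points of an edge are never missed
        together, and the exchange step turns this into closure of \<open>A\<close> under edges.
        Since \<open>M\<close> misses both \<open>w\<close> and \<open>w'\<close>, the latter stays
        outside.\<close>
      define A where "A = {x \<in> V. x = w \<or> \<not> (\<exists>N. matching E N \<and> card N = card M \<and> x \<notin> \<Union>N \<and> w \<notin> \<Union>N)}"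
      have "{x, y} \<notin> E" if xy: "x \<in> A" "y \<in> V - A" for x y
      proof
        assume e: "{x, y} \<in> E"
        have edge: "x \<in> \<Union>N \<or> y \<in> \<Union>N" if N: "matching E N" "card N = card M" for N
        proof (rule ccontr)
          assume "\<not> (x \<in> \<Union>N \<or> y \<in> \<Union>N)"
          then have "{x, y} \<inter> \<Union>N = {}" "{x, y} \<notin> N" by auto
          then show False using Mmax[OF matching_insert[OF N(1) e]] N finM[OF N(1)] by simp
        qed
        obtain K where K: "matching E K" "card K = card M" "y \<notin> \<Union>K" "w \<notin> \<Union>K" "y \<noteq> w"
          using xy by (auto simp: A_def)
        have "x \<noteq> w" using edge[OF K(1,2)] K by auto
        then have xw: "\<And>N. matching E N \<Longrightarrow> card N = card M \<Longrightarrow> x \<in> \<Union>N \<or> w \<in> \<Union>N"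
          using xy(1) by (auto simp: A_def)
        obtain N where N: "matching E N" "card N = card M" "x \<notin> \<Union>N"
          using miss[of x] xy(1) unfolding A_def by blast
        show False
        proof (rule gallai_swap[OF finE _ Mmax K(1,2,4,3) K(5)[symmetric] N])
          show "card e = 2" if "e \<in> E" for e using less.prems(2) that by blast
          show "w \<in> \<Union>L \<and> y \<in> \<Union>L" if "matching E L" "card L = card M" "x \<notin> \<Union>L" for L
            using xw[OF that(1,2)] edge[OF that(1,2)] that(3) by blast
        qed
      qed
      moreover have "w' \<notin> A" "w \<in> A" "A \<subseteq> V" using w M by (auto simp: A_def)
      ultimately show ?thesis by blast
    qed
    show ?thesis
    proof (intro exI conjI)
      show "matching E M" by (rule M)
      show "card ?W + 2 * card M = card V + card ({}::'a set)" using cW by simp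
      show "\<forall>w\<in>?W. \<forall>w'\<in>?W. w \<noteq> w' \<longrightarrow> (\<exists>A \<subseteq> V - {}. w \<in> A \<and> w' \<notin> A \<and>
        (\<forall>x\<in>A. \<forall>y\<in>V - {} - A. {x, y} \<notin> E))" using sep by auto
    qed auto
  qed
qed

section \<open>Strictly convex bodies and pencils of homothets\<close>

lemma plane_orthogonal_multiple:
  fixes n u z :: "real^2"
  assumes "n \<noteq> 0" "u \<noteq> 0" "n \<bullet> u = 0" "n \<bullet> z = 0"
  shows "\<exists>k. z = k *\<^sub>R u"
proof -
  have nu: "n$1 * u$1 + n$2 * u$2 = 0" "n$1 * z$1 + n$2 * z$2 = 0"
    using assms by (simp_all add: inner_vec_def sum_2)
  have n: "n$1 \<noteq> 0 \<or> n$2 \<noteq> 0" and u: "u$1 \<noteq> 0 \<or> u$2 \<noteq> 0"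
    using assms by (simp_all add: vec_eq_iff forall_2)
  have "n$1 * (u$1 * z$2 - u$2 * z$1) = 0" "n$2 * (u$1 * z$2 - u$2 * z$1) = 0"
    using nu by algebra+
  then have d: "u$1 * z$2 = u$2 * z$1" using n by auto
  show ?thesis
  proof (cases "u$1 = 0")
    case True
    then have "u$2 \<noteq> 0" using u by auto
    then have "z = (z$2 / u$2) *\<^sub>R u" using d True by (simp add: vec_eq_iff forall_2)
    then show ?thesis by blast
  next
    case False
    then have "z = (z$1 / u$1) *\<^sub>R u" using d by (simp add: vec_eq_iff forall_2 field_simps)
    then show ?thesis by blast
  qed
qed

definition perp :: "real^2 \<Rightarrow> real^2" where
  "perp u = vector [- u$2, u$1]"

lemma inner_perp [simp]: "perp u \<bullet> u = 0"
  by (simp add: perp_def inner_vec_def sum_2)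

lemma perp_eq_0 [simp]: "perp u = 0 \<longleftrightarrow> u = 0"
  by (auto simp: perp_def vec_eq_iff forall_2)

lemma convex_dilate: "convex X \<Longrightarrow> convex {x. k *\<^sub>R x + (z::real^2) \<in> X}"
proof -
  assume X: "convex X"
  have "linear ((*\<^sub>R) k :: real^2 \<Rightarrow> real^2)" by (simp add: linear_iff algebra_simps)
  then have "convex ((*\<^sub>R) k -` ((\<lambda>x. - z + x) ` X))" by (intro convex_linear_vimage convex_translation X)
  moreover have "(*\<^sub>R) k -` ((\<lambda>x. - z + x) ` X) = {x. k *\<^sub>R x + z \<in> X}"
    by (auto simp: image_iff algebra_simps intro: bexI[of _ "k *\<^sub>R _ + z"])
  ultimately show ?thesis by simp
qed

text \<open>For the functional with coefficients 1 and \<open>s\<close>, two distinct points clash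
  for at most one value of \<open>s\<close>, so a value outside the finite set \<open>bad\<close>
  separates all pairs. Its values serve as abscissas.\<close>

lemma inj_on_inner_generic:
  fixes T :: "(real^2) set"
  assumes "finite T"
  obtains \<kappa> where "\<kappa> \<noteq> 0" "inj_on (\<lambda>p. \<kappa> \<bullet> p) T"
proof -
  define bad where "bad = (\<lambda>(p, q). - (p$1 - q$1) / (p$2 - q$2)) ` (T \<times> T)"
  have "finite bad" using assms by (simp add: bad_def)
  then obtain s :: real where s: "s \<notin> bad" using ex_new_if_finite[OF infinite_UNIV_char_0] by blast
  define \<kappa> :: "real^2" where "\<kappa> = vector [1, s]"
  have "p = q" if pq: "p \<in> T" "q \<in> T" "\<kappa> \<bullet> p = \<kappa> \<bullet> q" for p q
  proof -
    have e: "p$1 + s * p$2 = q$1 + s * q$2" using pq by (simp add: \<kappa>_def inner_vec_def sum_2)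
    have "p$2 = q$2"
    proof (rule ccontr)
      assume ne: "p$2 \<noteq> q$2"
      then have "s = - (p$1 - q$1) / (p$2 - q$2)" using e by (simp add: field_simps)
      then have "s \<in> bad" using pq by (auto simp: bad_def intro!: image_eqI[of _ _ "(p, q)"])
      then show False using s by simp
    qed
    then show ?thesis using e by (simp add: vec_eq_iff forall_2)
  qed
  moreover have "\<kappa>$1 \<noteq> 0" by (simp add: \<kappa>_def)
  then have "\<kappa> \<noteq> 0" by auto
  ultimately show ?thesis using that[of \<kappa>] by (auto intro: inj_onI)
qed

lemma sort_three:
  fixes f :: "'a \<Rightarrow> real"
  assumes "inj_on f T" "a \<in> T" "b \<in> T" "c \<in> T" "a \<noteq> b" "b \<noteq> c" "a \<noteq> c"
  obtains a' b' c' where "{a', b', c'} = {a, b, c}" "f a' < f b'" "f b' < f c'"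
proof -
  have "f a \<noteq> f b" "f b \<noteq> f c" "f a \<noteq> f c" using assms by (auto simp: inj_on_def)
  then consider "f a < f b \<and> f b < f c" | "f a < f c \<and> f c < f b" | "f b < f a \<and> f a < f c"
    | "f b < f c \<and> f c < f a" | "f c < f a \<and> f a < f b" | "f c < f b \<and> f b < f a" by linarith
  then show ?thesis
    by cases (use that[of a b c] that[of a c b] that[of b a c] that[of b c a] that[of c a b] that[of c b a] in auto)
qed

section \<open>Strict convexity along lines and chords\<close>

text \<open>Strictness is assumed in the form in which it is applied, with open chords inside the
  interior. The formulation by boundary segments is reduced to it in
  \<open>strictly_convex_body_imp_strict_body\<close>.\<close>

locale strict_body =
  fixes C :: "(real^2) set"
  assumes convexC: "convex C" and compactC: "compact C" and int_ne: "interior C \<noteq> {}"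
    and strict: "\<lbrakk>x \<in> C; y \<in> C; x \<noteq> y; 0 < t; t < 1\<rbrakk> \<Longrightarrow> (1 - t) *\<^sub>R x + t *\<^sub>R y \<in> interior C"
begin

lemma closedC: "closed C" using compactC by (rule compact_imp_closed)

lemma int_C: "x \<in> interior C \<Longrightarrow> x \<in> C" using interior_subset by blast

lemma frontier_C: "x \<in> frontier C \<longleftrightarrow> x \<in> C \<and> x \<notin> interior C"
  using closedC by (auto simp: frontier_def)

lemma int_comb:
  assumes "x \<in> interior C" "y \<in> C" "0 \<le> t" "t < 1"
  shows "(1 - t) *\<^sub>R x + t *\<^sub>R y \<in> interior C"
proof (cases "x = y \<or> t = 0")
  case True
  then show ?thesis using assms by (auto simp: algebra_simps)
next
  case False
  then show ?thesis using assms strict int_C by simp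
qed

lemma between_int:
  assumes "y + r *\<^sub>R u \<in> C" "y + t *\<^sub>R u \<in> C" "u \<noteq> 0" "r < s" "s < t"
  shows "y + s *\<^sub>R u \<in> interior C"
proof -
  define k where "k = (s - r) / (t - r)"
  have k: "0 < k" "k < 1" using assms by (auto simp: k_def field_simps)
  have "k * (t - r) = s - r" using assms by (simp add: k_def)
  then have "(1 - k) * r + k * t = s" by algebra
  then have "(1 - k) *\<^sub>R (y + r *\<^sub>R u) + k *\<^sub>R (y + t *\<^sub>R u) = y + s *\<^sub>R u"
    by (auto simp: algebra_simps simp flip: scaleR_add_left)
  moreover have "y + r *\<^sub>R u \<noteq> y + t *\<^sub>R u" using assms by auto
  ultimately show ?thesis using strict[OF assms(1,2) _ k] by simp
qed

lemma between_int':
  assumes "y + r *\<^sub>R u \<in> interior C" "y + t *\<^sub>R u \<in> C" "r \<le> s \<and> s < t \<or> t < s \<and> s \<le> r"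
  shows "y + s *\<^sub>R u \<in> interior C"
proof (cases "u = 0 \<or> s = r")
  case False
  then show ?thesis using between_int[of y r u t s] between_int[of y t u r s] assms int_C by auto
qed (use assms in auto)

text \<open>Of three distinct boundary points on a line the middle one would be interior, so a line
  meets the boundary at most twice.\<close>

lemma frontier_collinear:
  assumes "y \<in> frontier C" "y + r *\<^sub>R u \<in> frontier C" "y + s *\<^sub>R u \<in> frontier C" "u \<noteq> 0"
    "r \<noteq> 0" "s \<noteq> 0" 
  shows "r = s"
proof (rule ccontr)
  assume "r \<noteq> s"
  then consider "0 < r \<and> r < s \<or> s < r \<and> r < 0" | "0 < s \<and> s < r \<or> r < s \<and> s < 0"
    | "r < 0 \<and> 0 < s \<or> s < 0 \<and> 0 < r" using assms by linarith
  then show False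
    using assms between_int[of y 0 u s r] between_int[of y s u 0 r] between_int[of y 0 u r s]
      between_int[of y r u 0 s] between_int[of y r u s 0] between_int[of y s u r 0]
    by cases (auto simp: frontier_C)
qed

lemma ray_frontier_unique:
  assumes "m \<in> interior C" "m + r *\<^sub>R u \<in> frontier C" "m + s *\<^sub>R u \<in> frontier C" "0 \<le> r" "0 \<le> s"
  shows "r = s"
  using assms between_int'[of m 0 u s r] between_int'[of m 0 u r s] by (cases r s rule: linorder_cases) (auto simp: frontier_C)

lemma chord_int:
  assumes "y \<in> frontier C" "y + l *\<^sub>R u \<in> frontier C" "l > 0" "y + k *\<^sub>R u \<in> interior C"
  shows "0 < k" "k < l"
proof -
  have y: "y \<in> C" "y \<notin> interior C" "y + l *\<^sub>R u \<in> C" "y + l *\<^sub>R u \<notin> interior C"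
    using assms by (auto simp: frontier_C)
  show "0 < k"
    using between_int'[of y k u l 0] y assms by (cases "k \<le> 0") auto
  show "k < l"
    using between_int'[of y k u 0 l] y assms by (cases "l \<le> k") auto
qed

text \<open>The homothet \<open>{a + p | l p + y \<in> C}\<close> passes through \<open>a\<close> and \<open>a + u\<close> iff \<open>y\<close> and \<open>y + l u\<close>
  are the end points of a chord of \<open>C\<close>; lowering that chord enlarges the part of the homothet
  above the line \<open>a, a + u\<close> and shrinks the part below it.\<close>
lemma chord_lower_above:
  assumes chord: "y \<in> frontier C" "y + l *\<^sub>R u \<in> frontier C" "l > 0"
    and chord': "y' \<in> frontier C" "y' + l' *\<^sub>R u \<in> frontier C" "l' > 0"
    and n: "n \<bullet> u = 0" "u \<noteq> 0" "n \<bullet> y' < n \<bullet> y"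
    and p: "l *\<^sub>R p + y \<in> C" "0 < n \<bullet> p"
  shows "l' *\<^sub>R p + y' \<in> interior C"
proof -
  define x where "x = l *\<^sub>R p + y"
  \<comment> \<open>The weight is chosen so that \<open>z\<close>, on the segment from
    \<open>x\<close> to \<open>y'\<close>, lies on the line of the upper chord. The triangle with
    apex \<open>x\<close> over the lower chord cuts that line in the segment from \<open>z\<close>
    to \<open>z + (\<mu> * l') *\<^sub>R u\<close>. Its ends are interior points, so it lies
    strictly inside the upper chord.\<close>
  define \<mu> where "\<mu> = (n \<bullet> x - n \<bullet> y) / (n \<bullet> x - n \<bullet> y')"
  have nx: "n \<bullet> x - n \<bullet> y = l * (n \<bullet> p)" by (simp add: x_def inner_add_right)
  then have nx': "n \<bullet> y < n \<bullet> x" using chord(3) p(2) by (metis diff_gt_0_iff_gt mult_pos_pos)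
  have \<mu>: "0 < \<mu>" "\<mu> < 1" using nx' n(3) by (auto simp: \<mu>_def)
  have yC: "y' \<in> C" "y' + l' *\<^sub>R u \<in> C" "x \<in> C" using chord' p by (auto simp: frontier_C x_def)
  have ne: "x \<noteq> y'" "x \<noteq> y' + l' *\<^sub>R u" using nx' n by (auto simp: inner_add_right)
  define z where "z = (1 - \<mu>) *\<^sub>R x + \<mu> *\<^sub>R y'"
  have z: "z \<in> interior C" unfolding z_def by (rule strict[OF yC(3,1) ne(1) \<mu>])
  have z2: "z + (\<mu> * l') *\<^sub>R u \<in> interior C"
    using strict[OF yC(3,2) ne(2) \<mu>] by (simp add: z_def algebra_simps)
  have "\<mu> * (n \<bullet> x - n \<bullet> y') = n \<bullet> x - n \<bullet> y" using nx' n(3) by (simp add: \<mu>_def)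
  then have "n \<bullet> (z - y) = 0" by (simp add: z_def inner_simps algebra_simps)
  moreover have "n \<noteq> 0" using n by auto
  ultimately obtain k where k: "z - y = k *\<^sub>R u" using plane_orthogonal_multiple n by blast
  then have zk: "z = y + k *\<^sub>R u" by (simp add: algebra_simps)
  have k0: "0 < k" using chord_int(1)[OF chord] z zk by blast
  have k1: "k + \<mu> * l' < l" using chord_int(2)[OF chord, of "k + \<mu> * l'"] z2 zk by (simp add: algebra_simps)
  \<comment> \<open>\<open>s\<close> and \<open>\<theta>\<close> solve the requirement that
    \<open>l' *\<^sub>R p + y'\<close> equals \<open>(1 - s) *\<^sub>R x + s *\<^sub>R q\<close>
    with \<open>q\<close> on the lower chord. The bounds \<open>k0\<close> and \<open>k1\<close>
    yield that both lie strictly between 0 and 1, so strict convexity applies to \<open>x\<close>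
    and \<open>q\<close>.\<close>
  define s where "s = 1 - \<mu> * l' / l"
  have ml: "\<mu> * l' > 0" using \<mu> chord' by simp
  have s: "0 < s" "s < 1" using k0 k1 ml chord(3) by (auto simp: s_def field_simps)
  define \<theta> where "\<theta> = k / (s * l)"
  have sl: "s * l = l - \<mu> * l'" using chord(3) by (simp add: s_def field_simps)
  have \<theta>: "0 < \<theta>" "\<theta> < 1" using k0 k1 sl s chord(3) by (auto simp: \<theta>_def field_simps)
  define q where "q = y' + (\<theta> * l') *\<^sub>R u"
  have "q = (1 - \<theta>) *\<^sub>R y' + \<theta> *\<^sub>R (y' + l' *\<^sub>R u)" by (simp add: q_def algebra_simps)
  then have qC: "q \<in> C" using convexD[OF convexC yC(1,2), of "1 - \<theta>" \<theta>] \<theta> by simp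
  have "n \<bullet> q < n \<bullet> x" using nx' n by (simp add: q_def inner_simps)
  then have "(1 - s) *\<^sub>R x + s *\<^sub>R q \<in> interior C" using strict[OF yC(3) qC _ s] by blast
  moreover have "(1 - s) *\<^sub>R x + s *\<^sub>R q = l' *\<^sub>R p + y'"
  proof -
    have kk: "(1 - \<mu>) *\<^sub>R (l *\<^sub>R p + y) + \<mu> *\<^sub>R y' = y + k *\<^sub>R u"
      using zk by (simp add: z_def x_def)
    have t: "s * \<theta> = k / l" using s chord(3) by (simp add: \<theta>_def)
    have "(1 - s) * x$i + s * q$i = l' * p$i + y'$i" for i
    proof -
      have e: "(1 - \<mu>) * (l * p$i + y$i) + \<mu> * y'$i = y$i + k * u$i"
        using arg_cong[OF kk, of "\<lambda>v. v$i"] by simp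
      have "s * q$i = s * y'$i + s * \<theta> * (l' * u$i)" by (simp add: q_def algebra_simps)
      also have "\<dots> = s * y'$i + k / l * (l' * u$i)" by (simp add: t)
      finally have "l * ((1 - s) * x$i + s * q$i) =
          (l - s * l) * x$i + (s * l) * y'$i + k * l' * u$i"
        using chord(3) by (simp add: field_simps)
      also have "\<dots> = l * (l' * p$i + y'$i)" using e sl unfolding x_def
        by simp algebra
      finally show ?thesis using chord(3) by simp
    qed
    then show ?thesis by (simp add: vec_eq_iff)
  qed
  ultimately show ?thesis by simp
qed

lemma chord_lower_below:
  assumes chord: "y \<in> frontier C" "y + l *\<^sub>R u \<in> frontier C" "l > 0"
    and chord': "y' \<in> frontier C" "y' + l' *\<^sub>R u \<in> frontier C" "l' > 0"
    and n: "n \<bullet> u = 0" "u \<noteq> 0" "n \<bullet> y' < n \<bullet> y"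
    and p: "l' *\<^sub>R p + y' \<in> C" "n \<bullet> p < 0"
  shows "l *\<^sub>R p + y \<in> interior C"
  using chord_lower_above[of "y'" l' u y l "- n" p] assms by simp

text \<open>A line carries at most one chord, so the height \<open>n \<bullet> y\<close> determines
  the member of the pencil of homothets through two fixed points.\<close>

lemma chord_unique:
  assumes chord: "y \<in> frontier C" "y + l *\<^sub>R u \<in> frontier C" "l > 0"
    and chord': "y' \<in> frontier C" "y' + l' *\<^sub>R u \<in> frontier C" "l' > 0"
    and n: "n \<bullet> u = 0" "u \<noteq> 0" "n \<noteq> 0" "n \<bullet> y' = n \<bullet> y"
  shows "l' = l" "y' = y"
proof -
  have "n \<bullet> (y' - y) = 0" using n by (simp add: inner_simps)
  then obtain k where "y' - y = k *\<^sub>R u" using plane_orthogonal_multiple n by blast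
  then have k: "y' = y + k *\<^sub>R u" by (simp add: algebra_simps)
  have k': "y + (k + l') *\<^sub>R u \<in> frontier C" using chord'(2) k by (simp add: algebra_simps)
  have "k = 0 \<or> k = l" using frontier_collinear[OF chord(1,2), of k] chord'(1) k n chord(3) by auto
  moreover have "k + l' = 0 \<or> k + l' = l" using frontier_collinear[OF chord(1,2) k'] n chord(3) by auto
  ultimately have "k = 0 \<and> l' = l" using chord(3) chord'(3) by auto
  then show "l' = l" "y' = y" using k by auto
qed

text \<open>The weak form of the monotonicity adds two boundary cases: chords of equal height
  coincide, and on the line of the two fixed points the interior of every member of the pencil cuts
  out the same open segment.\<close>

lemma chord_le_above:
  assumes chord: "y \<in> frontier C" "y + l *\<^sub>R u \<in> frontier C" "l > 0"
    and chord': "y' \<in> frontier C" "y' + l' *\<^sub>R u \<in> frontier C" "l' > 0"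
    and n: "n \<bullet> u = 0" "u \<noteq> 0" "n \<noteq> 0" "n \<bullet> y' \<le> n \<bullet> y"
    and p: "l *\<^sub>R p + y \<in> interior C" "0 \<le> n \<bullet> p"
  shows "l' *\<^sub>R p + y' \<in> interior C"
proof -
  consider "n \<bullet> y' = n \<bullet> y" | "n \<bullet> y' < n \<bullet> y" "0 < n \<bullet> p" | "n \<bullet> p = 0" using n p by linarith
  then show ?thesis
  proof cases
    case 1
    then show ?thesis using chord_unique[OF chord chord' n(1,2,3)] p by simp
  next
    case 2
    then show ?thesis using chord_lower_above[OF chord chord' n(1,2)] p int_C by blast
  next
    case 3
    then obtain k where k: "p = k *\<^sub>R u" using plane_orthogonal_multiple n by blast
    then have "y + (l * k) *\<^sub>R u \<in> interior C" using p by (simp add: algebra_simps)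
    then have "0 < l * k" "l * k < l * 1" using chord_int[OF chord, of "l * k"] by auto
    then have "0 < k" "k < 1" using chord(3) by (auto simp: zero_less_mult_iff)
    then have "y' + (k * l') *\<^sub>R u \<in> interior C"
      using chord' n(2) between_int[of y' 0 u l' "k * l'"] by (auto simp: frontier_C)
    then show ?thesis using k by (simp add: algebra_simps)
  qed
qed

lemma chord_le_below:
  assumes chord: "y \<in> frontier C" "y + l *\<^sub>R u \<in> frontier C" "l > 0"
    and chord': "y' \<in> frontier C" "y' + l' *\<^sub>R u \<in> frontier C" "l' > 0"
    and n: "n \<bullet> u = 0" "u \<noteq> 0" "n \<noteq> 0" "n \<bullet> y' \<le> n \<bullet> y"
    and p: "l' *\<^sub>R p + y' \<in> interior C" "n \<bullet> p \<le> 0"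
  shows "l *\<^sub>R p + y \<in> interior C"
  using chord_le_above[OF chord' chord, of "- n" p] assms by simp

text \<open>Lower the midpoint \<open>m\<close> of the chord by ever smaller amounts and shoot rays
  in the directions \<open>u\<close> and \<open>- u\<close>. Along a subsequence the two ray lengths
  converge, and both limits equal \<open>l / 2\<close> because a ray from an interior point meets
  the boundary only once. Hence the lowered chords converge to the given one, and as the complement
  of \<open>C\<close> is open, the finitely many excluded points stay excluded.\<close>

lemma chord_push:
  assumes chord: "y \<in> frontier C" "y + l *\<^sub>R u \<in> frontier C" "l > 0"
    and n: "n \<bullet> u = 0" "u \<noteq> 0" "n \<noteq> 0"
    and F: "finite F" "\<And>p. p \<in> F \<Longrightarrow> l *\<^sub>R p + y \<notin> C"
  obtains l' y' where "l' > 0" "y' \<in> frontier C" "y' + l' *\<^sub>R u \<in> frontier C" "n \<bullet> y' < n \<bullet> y"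
    "\<And>p. p \<in> F \<Longrightarrow> l' *\<^sub>R p + y' \<notin> C"
proof -
  define m where "m = y + (l / 2) *\<^sub>R u"
  have m: "m \<in> interior C"
    unfolding m_def using chord n(2) between_int[of y 0 u l "l / 2"] by (auto simp: frontier_C)
  have ym: "y = m + (l / 2) *\<^sub>R (- u)" "y + l *\<^sub>R u = m + (l / 2) *\<^sub>R u"
    by (auto simp: m_def algebra_simps simp flip: scaleR_add_left)
  obtain d where d: "d > 0" "ball m d \<subseteq> interior C"
    using m open_contains_ball[of "interior C"] by auto
  \<comment> \<open>With this constant every \<open>M k\<close> stays within \<open>d / 2\<close> of
    \<open>m\<close>, hence in the interior.\<close>
  define c where "c = d / (2 * norm n)"
  have c: "c > 0" using d n by (simp add: c_def)
  define M where "M k = m - (c / real (Suc k)) *\<^sub>R n" for k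
  have Mi: "M k \<in> interior C" for k
  proof -
    have "dist m (M k) = c / real (Suc k) * norm n" using c by (simp add: M_def dist_norm)
    also have "\<dots> = d / 2 / real (Suc k)" using n by (simp add: c_def)
    also have "\<dots> \<le> d / 2" using d by (simp add: divide_le_eq)
    finally show ?thesis using d by (intro subsetD[OF d(2)]) auto
  qed
  have bC: "bounded C" using compactC by (rule compact_imp_bounded)
  have ex: "\<exists>s. 0 < s \<and> M k + s *\<^sub>R v \<in> frontier C" if "v \<noteq> 0" for k v
    using ray_to_frontier[OF bC Mi that] by metis
  have "\<exists>s::nat \<Rightarrow> real. \<forall>k. 0 < s k \<and> M k + s k *\<^sub>R (- u) \<in> frontier C"
    using ex[of "- u"] n(2) by (intro choice) simp
  then obtain f where f: "\<And>k. 0 < f k" "\<And>k. M k + f k *\<^sub>R (- u) \<in> frontier C" by blast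
  have "\<exists>s::nat \<Rightarrow> real. \<forall>k. 0 < s k \<and> M k + s k *\<^sub>R u \<in> frontier C"
    using ex[of "u"] n(2) by (intro choice) simp
  then obtain g where g: "\<And>k. 0 < g k" "\<And>k. M k + g k *\<^sub>R u \<in> frontier C" by blast
  obtain B where B: "\<And>x. x \<in> C \<Longrightarrow> norm x \<le> B" using bC by (auto simp: bounded_iff)
  have bnd: "s \<le> 2 * B / norm u" if "0 < s" "M k + s *\<^sub>R v \<in> frontier C" "norm v = norm u" for s k v
  proof -
    have "norm (s *\<^sub>R v) \<le> norm (M k + s *\<^sub>R v) + norm (M k)"
      using norm_triangle_ineq4[of "M k + s *\<^sub>R v" "M k"] by simp
    also have "\<dots> \<le> 2 * B" using B[of "M k + s *\<^sub>R v"] B[OF int_C[OF Mi], of k] that by (simp add: frontier_C)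
    finally show ?thesis using that n by (simp add: field_simps)
  qed
  have "bounded (range (\<lambda>k. (f k, g k)))"
  proof (rule bounded_subset)
    show "bounded ({0..2 * B / norm u} \<times> {0..2 * B / norm u})" by (intro bounded_Times) auto
    show "range (\<lambda>k. (f k, g k)) \<subseteq> {0..2 * B / norm u} \<times> {0..2 * B / norm u}"
      using bnd[OF f] bnd[OF g] f(1) g(1) by (auto simp: less_imp_le)
  qed
  then obtain L r where r: "strict_mono (r::nat\<Rightarrow>nat)" and lim: "((\<lambda>k. (f k, g k)) \<circ> r) \<longlonglongrightarrow> L"
    using bounded_imp_convergent_subsequence by blast
  obtain \<alpha> \<beta> where L: "L = (\<alpha>, \<beta>)" by (cases L)
  have lf: "(\<lambda>k. f (r k)) \<longlonglongrightarrow> \<alpha>" and lg: "(\<lambda>k. g (r k)) \<longlonglongrightarrow> \<beta>"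
    using tendsto_fst[OF lim] tendsto_snd[OF lim] by (auto simp: L o_def)
  have "(\<lambda>k. c / real (Suc k)) \<longlonglongrightarrow> 0"
    using LIMSEQ_Suc[OF lim_const_over_n[of c]] by simp
  then have "(\<lambda>k. c / real (Suc (r k))) \<longlonglongrightarrow> 0" using LIMSEQ_subseq_LIMSEQ[OF _ r] by (auto simp: o_def)
  then have "(\<lambda>k. M (r k)) \<longlonglongrightarrow> m - 0 *\<^sub>R n" unfolding M_def by (intro tendsto_intros)
  then have lM: "(\<lambda>k. M (r k)) \<longlonglongrightarrow> m" by simp
  have ge: "0 \<le> \<alpha>" "0 \<le> \<beta>"
    using f(1) g(1) LIMSEQ_le_const[OF lf, of 0] LIMSEQ_le_const[OF lg, of 0] by (auto intro: less_imp_le)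
  have lF: "(\<lambda>k. M (r k) + f (r k) *\<^sub>R (- u)) \<longlonglongrightarrow> m + \<alpha> *\<^sub>R (- u)"
    by (intro tendsto_intros lM lf)
  have lG: "(\<lambda>k. M (r k) + g (r k) *\<^sub>R u) \<longlonglongrightarrow> m + \<beta> *\<^sub>R u"
    by (intro tendsto_intros lM lg)
  have "m + \<alpha> *\<^sub>R (- u) \<in> frontier C" "m + \<beta> *\<^sub>R u \<in> frontier C"
    using closed_sequentially[OF frontier_closed _ lF] closed_sequentially[OF frontier_closed _ lG] f(2) g(2)
    by blast+
  moreover have "m + (l / 2) *\<^sub>R (- u) \<in> frontier C" "m + (l / 2) *\<^sub>R u \<in> frontier C"
    using chord ym by metis+
  ultimately have \<alpha>: "\<alpha> = l / 2" and \<beta>: "\<beta> = l / 2"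
    using ray_frontier_unique[OF m, of \<alpha> "- u" "l / 2"] ray_frontier_unique[OF m, of \<beta> u "l / 2"]
      chord(3) ge by auto
  have "\<forall>\<^sub>F k in sequentially. \<forall>p\<in>F. (f (r k) + g (r k)) *\<^sub>R p + (M (r k) + f (r k) *\<^sub>R (- u)) \<notin> C"
  proof (intro eventually_ball_finite F(1) ballI)
    fix p assume "p \<in> F"
    have "(\<lambda>k. (f (r k) + g (r k)) *\<^sub>R p + (M (r k) + f (r k) *\<^sub>R (- u)))
        \<longlonglongrightarrow> (\<alpha> + \<beta>) *\<^sub>R p + (m + \<alpha> *\<^sub>R (- u))"
      by (intro tendsto_intros lM lf lg)
    moreover have "(\<alpha> + \<beta>) *\<^sub>R p + (m + \<alpha> *\<^sub>R (- u)) = l *\<^sub>R p + y"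
      using ym by (simp add: \<alpha> \<beta>)
    ultimately show "\<forall>\<^sub>F k in sequentially. (f (r k) + g (r k)) *\<^sub>R p + (M (r k) + f (r k) *\<^sub>R (- u)) \<notin> C"
      using topological_tendstoD[of _ _ sequentially "- C"] closedC F(2)[OF \<open>p \<in> F\<close>] by (auto simp: open_Compl)
  qed
  then obtain k where k: "\<forall>p\<in>F. (f (r k) + g (r k)) *\<^sub>R p + (M (r k) + f (r k) *\<^sub>R (- u)) \<notin> C"
    using eventually_happens'[OF sequentially_bot] by blast
  show ?thesis
  proof
    show "f (r k) + g (r k) > 0" using f(1)[of "r k"] g(1)[of "r k"] by simp
    show "M (r k) + f (r k) *\<^sub>R (- u) \<in> frontier C" by (rule f)
    show "M (r k) + f (r k) *\<^sub>R (- u) + (f (r k) + g (r k)) *\<^sub>R u \<in> frontier C"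
      using g(2)[of "r k"] by (simp add: algebra_simps)
    have "n \<bullet> n > 0" using n by simp
    then show "n \<bullet> (M (r k) + f (r k) *\<^sub>R (- u)) < n \<bullet> y"
      using c n(1) by (simp add: M_def ym(1) inner_simps)
  qed (use k in blast)
qed

section \<open>Shrinking homothets and connectedness of the induced graph\<close>

text \<open>The map in question describes the homothet scaled about \<open>o'\<close> by the factor
  \<open>1 / t\<close>. Take the largest \<open>t\<close> for which the scaled homothet still
  contains a point of \<open>Z\<close>; it exists by compactness, since \<open>o'\<close> is not in
  \<open>Z\<close>. A point of \<open>Z\<close> in its interior would survive a slightly larger
  \<open>t\<close>.\<close>

lemma rescale:
  assumes l: "l > 0" and Z: "finite Z" "o' \<notin> Z" and z0: "z0 \<in> Z" "t0 > 0" "l *\<^sub>R (o' + t0 *\<^sub>R (z0 - o')) + y \<in> C"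
  obtains t z where "t0 \<le> t" "z \<in> Z" "l *\<^sub>R (o' + t *\<^sub>R (z - o')) + y \<in> C"
    "\<And>z. z \<in> Z \<Longrightarrow> l *\<^sub>R (o' + t *\<^sub>R (z - o')) + y \<notin> interior C"
proof -
  define g where "g z t = l *\<^sub>R (o' + t *\<^sub>R (z - o')) + y" for z t
  have cont: "continuous_on UNIV (g z)" for z unfolding g_def by (intro continuous_intros)
  define K where "K = (\<Union>z\<in>Z. {t. 0 \<le> t \<and> g z t \<in> C})"
  obtain B where B: "\<And>x. x \<in> C \<Longrightarrow> norm x \<le> B" using compact_imp_bounded[OF compactC] by (auto simp: bounded_iff)
  have "compact {t. 0 \<le> t \<and> g z t \<in> C}" if "z \<in> Z" for z
  proof -
    have "{t. 0 \<le> t \<and> g z t \<in> C} = {0..} \<inter> g z -` C" by auto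
    moreover have "closed (g z -` C)" by (rule closed_vimage[OF closedC cont])
    ultimately have "closed {t. 0 \<le> t \<and> g z t \<in> C}" by auto
    moreover have "bounded {t. 0 \<le> t \<and> g z t \<in> C}"
    proof (rule bounded_subset)
      show "bounded {0..(B + norm (l *\<^sub>R o' + y)) / (l * norm (z - o'))}" by simp
      show "{t. 0 \<le> t \<and> g z t \<in> C} \<subseteq> {0..(B + norm (l *\<^sub>R o' + y)) / (l * norm (z - o'))}"
      proof clarsimp
        fix t assume t: "0 \<le> t" "g z t \<in> C"
        have "norm ((l * t) *\<^sub>R (z - o')) = norm (g z t - (l *\<^sub>R o' + y))"
          by (simp add: g_def algebra_simps)
        also have "\<dots> \<le> B + norm (l *\<^sub>R o' + y)"
          using norm_triangle_ineq4[of "g z t"] B[OF t(2)] by (meson add_right_mono order_trans)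
        finally have "l * t * norm (z - o') \<le> B + norm (l *\<^sub>R o' + y)" using l t by (simp add: abs_mult)
        moreover have "norm (z - o') > 0" using Z that by auto
        ultimately show "t \<le> (B + norm (l *\<^sub>R o' + y)) / (l * norm (z - o'))"
          using l by (simp add: pos_le_divide_eq algebra_simps)
      qed
    qed
    ultimately show ?thesis by (simp add: compact_eq_bounded_closed)
  qed
  then have "compact K" unfolding K_def using Z by (intro compact_UN) auto
  moreover have t0: "t0 \<in> K" using z0 by (auto simp: K_def g_def)
  ultimately obtain t where t: "t \<in> K" "\<And>s. s \<in> K \<Longrightarrow> s \<le> t"
    using compact_attains_sup[of K] by blast
  then obtain z where z: "z \<in> Z" "0 \<le> t" "g z t \<in> C" by (auto simp: K_def)
  have "g z t \<notin> interior C" if "z \<in> Z" for z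
  proof
    assume "g z t \<in> interior C"
    moreover have "open (g z -` interior C)" by (rule open_vimage[OF open_interior cont])
    ultimately obtain e where e: "e > 0" "ball t e \<subseteq> g z -` interior C"
      using open_contains_ball by blast
    have "t + e / 2 \<in> ball t e" using e by (simp add: dist_norm)
    then have "g z (t + e / 2) \<in> C" using e int_C by blast
    then have "t + e / 2 \<in> K" using e \<open>0 \<le> t\<close> that by (auto simp: K_def)
    then show False using t(2) e by fastforce
  qed
  then show ?thesis using that[of t z] t(2)[OF t0] z by (auto simp: g_def)
qed

text \<open>This is the connectedness of the subgraph induced by a homothet. Among the homothets
  whose points of \<open>S\<close> lie in \<open>A \<union> B\<close> and meet both sets, take one
  with the fewest points. Shrinking it twice brings all its points to the boundary. A third point
  besides \<open>p\<close> and \<open>q\<close> could then be dropped by moving within the pencil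
  through \<open>p\<close> and \<open>q\<close>, against minimality.\<close>

lemma edge_between:
  assumes S: "finite S" and AB: "A \<inter> B = {}"
    and D: "l > 0" "\<And>x. x \<in> S \<Longrightarrow> l *\<^sub>R x + y \<in> C \<Longrightarrow> x \<in> A \<union> B"
    and a: "a \<in> S" "a \<in> A" "l *\<^sub>R a + y \<in> C"
    and b: "b \<in> S" "b \<in> B" "l *\<^sub>R b + y \<in> C"
  shows "\<exists>l y p q. l > 0 \<and> p \<in> A \<and> q \<in> B \<and> {x \<in> S. l *\<^sub>R x + y \<in> C} = {p, q}"
proof -
  define H where "H = (\<lambda>(l, y). {x \<in> S. l *\<^sub>R x + y \<in> C})"
  define P where "P d \<longleftrightarrow> fst d > 0 \<and> H d \<subseteq> A \<union> B \<and> H d \<inter> A \<noteq> {} \<and> H d \<inter> B \<noteq> {}" for d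
  have "P (l, y)" using D a b by (auto simp: P_def H_def)
  then obtain d where d: "P d" and dmin: "\<And>d'. P d' \<Longrightarrow> card (H d) \<le> card (H d')"
    using ex_has_least_nat[of P "(l, y)" "\<lambda>d. card (H d)"] by blast
  have finH: "finite (H d)" for d using S by (auto simp: H_def split: prod.split)
  have same: "H d' = H d" if "P d'" "H d' \<subseteq> H d" for d'
    using card_seteq[OF finH that(2)] dmin[OF that(1)] by blast
  obtain l0 y0 where d0: "d = (l0, y0)" by (cases d)
  have l0: "l0 > 0" using d d0 by (simp add: P_def)
  \<comment> \<open>One shrinking about a point of \<open>X\<close> clears the interior of points of
    \<open>Y\<close>, and minimality keeps the set of contained points. The last clause says that
    the interior only shrinks, so a second application with the roles exchanged preserves what the
    first achieved.\<close>
  have scale: "\<exists>l2 y2. P (l2, y2) \<and> H (l2, y2) = H d \<and> (\<forall>z\<in>H d \<inter> Y. l2 *\<^sub>R z + y2 \<notin> interior C) \<and>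
      (\<forall>x. l2 *\<^sub>R x + y2 \<in> interior C \<longrightarrow> l1 *\<^sub>R x + y1 \<in> interior C)"
    if P1: "P (l1, y1)" "H (l1, y1) = H d" and xy: "X = A \<and> Y = B \<or> X = B \<and> Y = A" for l1 y1 X Y
  proof -
    have l1: "l1 > 0" using P1 by (simp add: P_def)
    obtain p q where p: "p \<in> H d \<inter> X" and q: "q \<in> H d \<inter> Y" using d xy by (auto simp: P_def)
    have pC: "l1 *\<^sub>R p + y1 \<in> C" and qC: "l1 *\<^sub>R q + y1 \<in> C" using p q P1(2) by (auto simp: H_def)
    obtain t z where t: "1 \<le> t" "z \<in> H d \<inter> Y" "l1 *\<^sub>R (p + t *\<^sub>R (z - p)) + y1 \<in> C"
      "\<And>z. z \<in> H d \<inter> Y \<Longrightarrow> l1 *\<^sub>R (p + t *\<^sub>R (z - p)) + y1 \<notin> interior C"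
    proof (rule rescale[OF l1, of "H d \<inter> Y" p q 1 y1])
      show "p \<notin> H d \<inter> Y" using p xy AB by auto
    qed (use finH q qC in auto)
    let ?l = "l1 * t" and ?y = "l1 *\<^sub>R ((1 - t) *\<^sub>R p) + y1"
    have eq: "l1 *\<^sub>R (p + t *\<^sub>R (x - p)) + y1 = ?l *\<^sub>R x + ?y" for x by (simp add: algebra_simps)
    \<comment> \<open>The old image is a convex combination of the new image and the image of the
      centre \<open>p\<close>, so the shrunk homothet lies in the old one.\<close>
    have bk: "l1 *\<^sub>R x + y1 = (1 - (1 - 1/t)) *\<^sub>R (?l *\<^sub>R x + ?y) + (1 - 1/t) *\<^sub>R (l1 *\<^sub>R p + y1)" for x
    proof -
      have "l1 * x$i + y1$i = (1 - (1 - 1/t)) * (?l * x$i + (l1 * ((1 - t) * p$i) + y1$i))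
          + (1 - 1/t) * (l1 * p$i + y1$i)" for i
        using t(1) by (simp add: field_simps)
      then show ?thesis by (simp add: vec_eq_iff)
    qed
    have t1: "0 \<le> 1 - 1/t" "1 - 1/t < 1" using t(1) by auto
    have inC: "l1 *\<^sub>R x + y1 \<in> C" if "?l *\<^sub>R x + ?y \<in> C" for x
      unfolding bk[of x] using convexD[OF convexC that pC, of "1 - (1 - 1/t)" "1 - 1/t"] t1 t(1) by simp
    have inI: "l1 *\<^sub>R x + y1 \<in> interior C" if "?l *\<^sub>R x + ?y \<in> interior C" for x
      unfolding bk[of x] by (rule int_comb[OF that pC t1])
    have sub: "H (?l, ?y) \<subseteq> H d" using inC P1(2) by (auto simp: H_def)
    have pe: "?l *\<^sub>R p + ?y = l1 *\<^sub>R p + y1" by (simp add: algebra_simps)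
    have "?l *\<^sub>R p + ?y \<in> C" unfolding pe by (rule pC)
    then have "p \<in> H (?l, ?y)" using p d0 by (simp add: H_def)
    moreover have "z \<in> H (?l, ?y)" using t(2,3) d0 by (simp add: H_def eq)
    moreover have "H (?l, ?y) \<subseteq> A \<union> B" using sub d by (auto simp: P_def)
    moreover have "?l > 0" using l1 t(1) by simp
    ultimately have P2: "P (?l, ?y)" using p t(2) xy by (auto simp: P_def)
    have "\<forall>z\<in>H d \<inter> Y. ?l *\<^sub>R z + ?y \<notin> interior C" using t(4) by (simp add: eq)
    then show ?thesis using P2 same[OF P2 sub] inI by blast
  qed
  obtain l1 y1 where D1: "P (l1, y1)" "H (l1, y1) = H d" "\<forall>z\<in>H d \<inter> B. l1 *\<^sub>R z + y1 \<notin> interior C"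
    using scale[of l0 y0 A B] d d0 by blast
  obtain l2 y2 where D2: "P (l2, y2)" "H (l2, y2) = H d" "\<forall>z\<in>H d \<inter> A. l2 *\<^sub>R z + y2 \<notin> interior C"
    "\<forall>x. l2 *\<^sub>R x + y2 \<in> interior C \<longrightarrow> l1 *\<^sub>R x + y1 \<in> interior C"
    using scale[of l1 y1 B A] D1 by blast
  have l2: "l2 > 0" using D2 by (simp add: P_def)
  have fr: "l2 *\<^sub>R x + y2 \<in> frontier C" if "x \<in> H d" for x
  proof -
    have "l2 *\<^sub>R x + y2 \<in> C" using that D2(2) by (auto simp: H_def)
    moreover have "x \<in> A \<union> B" using that d by (auto simp: P_def)
    ultimately show ?thesis using D2 D1 that by (auto simp: frontier_C)
  qed
  obtain p q where p: "p \<in> H d" "p \<in> A" and q: "q \<in> H d" "q \<in> B" using d by (auto simp: P_def)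
  have "H d = {p, q}"
  proof (rule ccontr)
    assume "H d \<noteq> {p, q}"
    then obtain x where x: "x \<in> H d" "x \<noteq> p" "x \<noteq> q" using p q by blast
    define u where "u = q - p"
    have u: "u \<noteq> 0" using p q AB by (auto simp: u_def)
    have nx: "perp u \<bullet> (x - p) \<noteq> 0"
    proof
      assume "perp u \<bullet> (x - p) = 0"
      then obtain k where "x - p = k *\<^sub>R u" using plane_orthogonal_multiple[of "perp u" u] u by auto
      then have xk: "x = p + k *\<^sub>R u" by (simp add: algebra_simps)
      have "l2 *\<^sub>R p + y2 + l2 *\<^sub>R u \<in> frontier C"
        using fr[OF q(1)] by (simp add: u_def algebra_simps)
      moreover have "l2 *\<^sub>R p + y2 + (l2 * k) *\<^sub>R u \<in> frontier C"
        using fr[OF x(1)] by (simp add: xk algebra_simps)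
      moreover have "k \<noteq> 0" using x xk by auto
      ultimately have "l2 = l2 * k"
        using frontier_collinear[OF fr[OF p(1)] _ _ u, of l2 "l2 * k"] l2 by auto
      then show False using l2 x xk by (simp add: u_def)
    qed
    \<comment> \<open>The sign of the normal puts \<open>x\<close> below the line through
      \<open>p\<close> and \<open>q\<close>. Lowering the chord shrinks that side, and the boundary
      point \<open>x\<close> drops out.\<close>
    define n where "n = (if perp u \<bullet> (x - p) < 0 then perp u else - perp u)"
    have n: "n \<bullet> u = 0" "n \<noteq> 0" "n \<bullet> (x - p) < 0" using nx u by (auto simp: n_def)
    have c: "l2 *\<^sub>R p + y2 \<in> frontier C" "l2 *\<^sub>R p + y2 + l2 *\<^sub>R u \<in> frontier C"
      using fr[OF p(1)] fr[OF q(1)] by (simp_all add: u_def algebra_simps)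
    have F: "finite ((\<lambda>z. z - p) ` (S - H d))" using S by simp
    obtain l' y' where D': "l' > 0" "y' \<in> frontier C" "y' + l' *\<^sub>R u \<in> frontier C"
      "n \<bullet> y' < n \<bullet> (l2 *\<^sub>R p + y2)" "\<And>v. v \<in> (\<lambda>z. z - p) ` (S - H d) \<Longrightarrow> l' *\<^sub>R v + y' \<notin> C"
    proof (rule chord_push[OF c l2 n(1) u n(2) F])
      fix v assume "v \<in> (\<lambda>z. z - p) ` (S - H d)"
      then obtain z where z: "z \<in> S" "z \<notin> H d" "v = z - p" by blast
      then have "l2 *\<^sub>R z + y2 \<notin> C" using D2(2) by (auto simp: H_def)
      moreover have "l2 *\<^sub>R v + (l2 *\<^sub>R p + y2) = l2 *\<^sub>R z + y2" by (simp add: z(3) algebra_simps)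
      ultimately show "l2 *\<^sub>R v + (l2 *\<^sub>R p + y2) \<notin> C" by metis
    qed blast
    let ?d = "(l', y' - l' *\<^sub>R p)"
    have Hd: "H ?d = {z \<in> S. l' *\<^sub>R (z - p) + y' \<in> C}" by (simp add: H_def algebra_simps)
    have sub: "H ?d \<subseteq> H d" using D'(5) by (auto simp: Hd)
    moreover have "p \<in> H ?d" "q \<in> H ?d" using p q D' d0
      by (auto simp: Hd H_def frontier_C u_def algebra_simps)
    moreover have "H d \<subseteq> A \<union> B" using d by (simp add: P_def)
    ultimately have "P ?d" using D'(1) p q by (auto simp: P_def)
    then have "H ?d = H d" using same sub by blast
    then have "l' *\<^sub>R (x - p) + y' \<in> C" using x by (auto simp: Hd)
    then have "l2 *\<^sub>R (x - p) + (l2 *\<^sub>R p + y2) \<in> interior C"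
      using chord_lower_below[OF c l2 D'(2,3,1) n(1) u D'(4)] n(3) by blast
    then show False using fr[OF x(1)] by (simp add: frontier_C algebra_simps)
  qed
  then have "{x \<in> S. l0 *\<^sub>R x + y0 \<in> C} = {p, q}" using d0 by (simp add: H_def)
  then show ?thesis using l0 p q by blast
qed

section \<open>Two homothets with a common boundary point\<close>

lemma inner_le_closure_interior:
  assumes "\<And>x. x \<in> interior C \<Longrightarrow> \<nu> \<bullet> x \<le> s" "x \<in> C"
  shows "\<nu> \<bullet> x \<le> s"
proof -
  have "closure (interior C) \<subseteq> {x. \<nu> \<bullet> x \<le> s}"
    using assms(1) by (intro closure_minimal closed_halfspace_le) auto
  then show ?thesis
    using assms(2) convex_closure_interior[OF convexC int_ne] closedC by auto
qed

text \<open>The boundary of a planar convex body minus a point is homeomorphic to a line.\<close>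

lemma connected_frontier_minus:
  assumes "b \<in> frontier C"
  shows "connected (frontier C - {b})"
proof -
  have rf: "rel_frontier C = frontier C"
    using int_ne by (simp add: rel_frontier_def frontier_def rel_interior_nonempty_interior)
  obtain T :: "(real^2) set" where T: "affine T" "aff_dim T = 1"
    using choose_affine_subset[OF affine_UNIV, of 1] by auto
  have "aff_dim C = 2" using int_ne by (simp add: aff_dim_nonempty_interior)
  then have "rel_frontier C - {b} homeomorphic T"
    using assms rf T compact_imp_bounded[OF compactC]
    by (intro homeomorphic_punctured_sphere_affine_gen convexC) auto
  then show ?thesis
    using rf homeomorphic_connectedness affine_imp_convex[OF T(1)] convex_connected by metis
qed

text \<open>Two homothets through a common boundary point \<open>b\<close>, each with a Delaunay triangle at \<open>b\<close> whose
  vertices the other one does not contain: a line through \<open>b\<close> separates the two triangles,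
  so they cannot both contain the same germ of a ray at \<open>b\<close>.\<close>
lemma homothet_germ_unique:
  assumes k: "k > 0" and b: "b \<in> frontier C" "k *\<^sub>R b + z \<in> frontier C"
    and a: "a \<in> frontier C" "c \<in> frontier C" "a \<noteq> b" "c \<noteq> b" "a \<noteq> c"
      "k *\<^sub>R a + z \<notin> interior C" "k *\<^sub>R c + z \<notin> interior C"
    and a': "k *\<^sub>R a' + z \<in> frontier C" "k *\<^sub>R c' + z \<in> frontier C" "a' \<notin> interior C" "c' \<notin> interior C" "a' \<noteq> b"
    and comb: "\<alpha> > 0" "\<beta> > 0" "\<alpha>' > 0" "\<beta>' > 0"
      "\<alpha> *\<^sub>R (a - b) + \<beta> *\<^sub>R (c - b) = \<alpha>' *\<^sub>R (a' - b) + \<beta>' *\<^sub>R (c' - b)"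
  shows "k = 1 \<and> z = 0"
proof -
  \<comment> \<open>If a line through \<open>b\<close> had \<open>a\<close>, \<open>c\<close> weakly
    on one side and \<open>a'\<close>, \<open>c'\<close> weakly on the other, the common vector in
    \<open>comb\<close> would lie on that line. This forces \<open>a\<close>, \<open>b\<close>,
    \<open>c\<close> to be collinear, impossible for three boundary points.\<close>
  have sep: False if \<nu>: "\<nu> \<noteq> 0" "\<nu> \<bullet> (a - b) \<le> 0" "\<nu> \<bullet> (c - b) \<le> 0" "0 \<le> \<nu> \<bullet> (a' - b)" "0 \<le> \<nu> \<bullet> (c' - b)" for \<nu>
  proof -
    have e: "\<alpha> * (\<nu> \<bullet> (a - b)) + \<beta> * (\<nu> \<bullet> (c - b)) = \<alpha>' * (\<nu> \<bullet> (a' - b)) + \<beta>' * (\<nu> \<bullet> (c' - b))"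
      using arg_cong[OF comb(5), of "\<lambda>v. \<nu> \<bullet> v"] by (simp only: inner_add_right inner_scaleR_right)
    have "\<alpha> * (\<nu> \<bullet> (a - b)) \<le> 0" "\<beta> * (\<nu> \<bullet> (c - b)) \<le> 0" "0 \<le> \<alpha>' * (\<nu> \<bullet> (a' - b))" "0 \<le> \<beta>' * (\<nu> \<bullet> (c' - b))"
      using \<nu> comb by (simp_all add: mult_nonneg_nonpos)
    then have "\<alpha> * (\<nu> \<bullet> (a - b)) = 0" "\<beta> * (\<nu> \<bullet> (c - b)) = 0" using e by linarith+
    then have "\<nu> \<bullet> (a - b) = 0" "\<nu> \<bullet> (c - b) = 0" using comb by auto
    then obtain r where "c - b = r *\<^sub>R (a - b)" using plane_orthogonal_multiple[of \<nu> "a - b" "c - b"] \<nu> a by auto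
    then have r: "c = b + r *\<^sub>R (a - b)" by (simp add: algebra_simps)
    then have "1 = r" using frontier_collinear[of b 1 "a - b" r] a b by auto
    then show False using r a by simp
  qed
  \<comment> \<open>A second common boundary point \<open>e\<close> places both homothets in the
    pencil through \<open>b\<close> and \<open>e\<close>. Unless their chords have equal height,
    monotonicity makes the line through \<open>b\<close> and \<open>e\<close> a separating
    line.\<close>
  have second: "k = 1 \<and> z = 0" if e: "e \<noteq> b" "e \<in> frontier C" "k *\<^sub>R e + z \<in> frontier C" for e
  proof -
    define u where "u = e - b"
    have u: "u \<noteq> 0" using e by (simp add: u_def)
    have c1: "b \<in> frontier C" "b + 1 *\<^sub>R u \<in> frontier C" "(1::real) > 0" using b e by (auto simp: u_def)
    have c2: "k *\<^sub>R b + z \<in> frontier C" "k *\<^sub>R b + z + k *\<^sub>R u \<in> frontier C" "k > 0"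
      using b e k by (auto simp: u_def algebra_simps)
    have n: "perp u \<bullet> u = 0" "perp u \<noteq> 0" using u by auto
    have inC: "x \<in> frontier C \<Longrightarrow> 1 *\<^sub>R (x - b) + b \<in> C" for x by (simp add: frontier_C)
    have inC': "k *\<^sub>R x + z \<in> frontier C \<Longrightarrow> k *\<^sub>R (x - b) + (k *\<^sub>R b + z) \<in> C" for x
      by (simp add: frontier_C algebra_simps)
    have ni: "k *\<^sub>R x + z \<notin> interior C \<Longrightarrow> k *\<^sub>R (x - b) + (k *\<^sub>R b + z) \<notin> interior C" for x
      by (simp add: algebra_simps)
    have ni': "x \<notin> interior C \<Longrightarrow> 1 *\<^sub>R (x - b) + b \<notin> interior C" for x by simp
    consider "perp u \<bullet> (k *\<^sub>R b + z) < perp u \<bullet> b" | "perp u \<bullet> (k *\<^sub>R b + z) = perp u \<bullet> b"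
      | "perp u \<bullet> b < perp u \<bullet> (k *\<^sub>R b + z)" by linarith
    then show ?thesis
    proof cases
      case 1
      note up = chord_lower_above[OF c1 c2 n(1) u 1] and dn = chord_lower_below[OF c1 c2 n(1) u 1]
      have "\<not> 0 < perp u \<bullet> (a - b)" "\<not> 0 < perp u \<bullet> (c - b)" "\<not> perp u \<bullet> (a' - b) < 0" "\<not> perp u \<bullet> (c' - b) < 0"
        using up[OF inC] dn[OF inC'] ni ni' a a' by blast+
      then show ?thesis using sep[of "perp u"] n(2) by (simp add: not_less)
    next
      case 2
      have "k = 1" "k *\<^sub>R b + z = b" using chord_unique[OF c1 c2 n(1) u n(2) 2] by auto
      then show ?thesis by simp
    next
      case 3
      note up = chord_lower_above[OF c2 c1 n(1) u 3] and dn = chord_lower_below[OF c2 c1 n(1) u 3]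
      have "\<not> 0 < perp u \<bullet> (a' - b)" "\<not> 0 < perp u \<bullet> (c' - b)" "\<not> perp u \<bullet> (a - b) < 0" "\<not> perp u \<bullet> (c - b) < 0"
        using up[OF inC'] dn[OF inC] ni ni' a a' by blast+
      then show ?thesis using sep[of "- perp u"] n(2) by (simp add: not_less)
    qed
  qed
  let ?D = "{x. k *\<^sub>R x + z \<in> C}" and ?I = "{x. k *\<^sub>R x + z \<in> interior C}"
  have inv: "k *\<^sub>R ((1 / k) *\<^sub>R (x - z)) + z = x" for x using k by simp
  show ?thesis
  \<comment> \<open>If the interiors are disjoint, a separating hyperplane passes through
    \<open>b\<close> and \<open>sep\<close> applies. If they overlap, a second common boundary point
    is found.\<close>
  proof (cases "interior C \<inter> ?I = {}")
    case True
    obtain p where "p \<in> interior C" using int_ne by blast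
    then have "(1 / k) *\<^sub>R (p - z) \<in> ?I" by (simp add: inv del: scaleR_scaleR)
    then have "?I \<noteq> {}" by blast
    then obtain \<nu> s where \<nu>: "\<nu> \<noteq> 0" "\<forall>x\<in>interior C. \<nu> \<bullet> x \<le> s" "\<forall>x\<in>?I. s \<le> \<nu> \<bullet> x"
      using separating_hyperplane_sets[OF convex_interior[OF convexC] convex_dilate[OF convex_interior[OF convexC]] int_ne _ True]
      by blast
    have le: "\<nu> \<bullet> x \<le> s" if "x \<in> C" for x using inner_le_closure_interior[OF _ that] \<nu>(2) by blast
    have ge: "s \<le> \<nu> \<bullet> x" if "k *\<^sub>R x + z \<in> C" for x
    proof -
      have "(- \<nu>) \<bullet> y \<le> - (k * s + \<nu> \<bullet> z)" if "y \<in> interior C" for y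
      proof -
        have "(1 / k) *\<^sub>R (y - z) \<in> ?I" using that by (simp add: inv del: scaleR_scaleR)
        then have "s \<le> \<nu> \<bullet> ((1 / k) *\<^sub>R (y - z))" using \<nu>(3) by blast
        then have "s \<le> (1 / k) * (\<nu> \<bullet> (y - z))" by (simp only: inner_scaleR_right)
        then have "k * s \<le> \<nu> \<bullet> (y - z)" using k by (simp add: pos_le_divide_eq mult.commute)
        then show ?thesis by (simp add: inner_simps)
      qed
      then have "(- \<nu>) \<bullet> (k *\<^sub>R x + z) \<le> - (k * s + \<nu> \<bullet> z)" by (rule inner_le_closure_interior[OF _ that])
      then have "k * s \<le> k * (\<nu> \<bullet> x)" by (simp add: inner_simps)
      then show ?thesis using k by simp
    qed
    have "\<nu> \<bullet> b = s" using le[of b] ge[of b] b by (auto simp: frontier_C)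
    then show ?thesis
      using sep[of \<nu>] \<nu>(1) le[of a] le[of c] ge[of a'] ge[of c'] a a' by (simp add: frontier_C inner_simps)
  next
    case False
    then obtain m where m: "m \<in> interior C" "k *\<^sub>R m + z \<in> interior C" by blast
    have "\<exists>e. e \<noteq> b \<and> e \<in> frontier C \<and> k *\<^sub>R e + z \<in> frontier C"
    proof (cases "a \<in> ?D \<or> a' \<in> C")
      case True
      then show ?thesis
      proof
        assume "a \<in> ?D"
        then show ?thesis using a by (intro exI[of _ a]) (auto simp: frontier_C)
      next
        assume "a' \<in> C"
        then show ?thesis using a' by (intro exI[of _ a']) (auto simp: frontier_C)
      qed
    next
      case False
      \<comment> \<open>Where the segment from \<open>m\<close> to \<open>a'\<close> leaves
        \<open>C\<close>, there is a boundary point \<open>x\<close> of \<open>C\<close> interior to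
        the second homothet, while \<open>a\<close> is a boundary point of \<open>C\<close> outside
        it. The boundary of \<open>C\<close> without \<open>b\<close> is connected, so it crosses
        the other boundary at a point other than \<open>b\<close>.\<close>
      have "closed_segment m a' \<inter> frontier C \<noteq> {}"
        using False m int_C by (intro connected_Int_frontier connected_segment) auto
      then obtain x t where x: "x \<in> frontier C" "x = (1 - t) *\<^sub>R m + t *\<^sub>R a'" "0 \<le> t" "t \<le> 1"
        unfolding closed_segment_def by blast
      have "t \<noteq> 1" using x False by (auto simp: frontier_C)
      moreover have "k *\<^sub>R x + z = (1 - t) *\<^sub>R (k *\<^sub>R m + z) + t *\<^sub>R (k *\<^sub>R a' + z)"
        by (simp add: x(2) algebra_simps)
      ultimately have xi: "k *\<^sub>R x + z \<in> interior C"
        using int_comb[OF m(2), of "k *\<^sub>R a' + z" t] x a' by (simp add: frontier_C)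
      then have "x \<noteq> b" using b by (auto simp: frontier_C)
      then have "(frontier C - {b}) \<inter> frontier ?D \<noteq> {}"
        using x xi int_C a False
        by (intro connected_Int_frontier connected_frontier_minus b) auto
      then obtain e where e: "e \<in> frontier C" "e \<noteq> b" "e \<in> frontier ?D" by blast
      have cont: "continuous_on UNIV (\<lambda>x. k *\<^sub>R x + z)" by (intro continuous_intros)
      have "closed ?D" "open ?I"
        using closed_vimage[OF closedC cont] open_vimage[OF open_interior cont, of C] by (auto simp: vimage_def)
      moreover have "?I \<subseteq> ?D" using int_C by auto
      ultimately have "frontier ?D \<subseteq> ?D" "?I \<subseteq> interior ?D"
        using interior_maximal[of ?I ?D] by (simp_all add: frontier_subset_eq)
      moreover have "e \<notin> interior ?D" using e(3) by (simp add: frontier_def)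
      ultimately have "k *\<^sub>R e + z \<in> frontier C" using e(3) frontier_C by blast
      then show ?thesis using e by blast
    qed
    then show ?thesis using second by blast
  qed
qed

section \<open>Delaunay triangles and illumination\<close>

text \<open>In the pencil through \<open>a\<close> and \<open>c\<close>, take the empty homothet
  with the lowest chord. The bound \<open>r\<close> keeps \<open>l\<close> away from 0 and makes the
  set of candidates compact. Lowering enlarges the side of \<open>w\<close>, so \<open>w\<close>
  remains interior. If no third point of \<open>T\<close> were met on that side,
  \<open>chord_push\<close> would allow a lower chord: points above stay outside, and points below
  cannot enter the interior.\<close>

lemma delaunay_push:
  assumes T: "finite T" "a \<in> T" "c \<in> T" "a \<noteq> c"
    and n: "n \<bullet> (c - a) = 0" "n \<noteq> 0"
    and D: "l > 0" "l *\<^sub>R a + y \<in> C" "l *\<^sub>R c + y \<in> C" "\<And>z. z \<in> T \<Longrightarrow> l *\<^sub>R z + y \<notin> interior C"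
    and w: "l *\<^sub>R w + y \<in> interior C" "0 \<le> n \<bullet> (w - a)"
    and r: "r > 0" "\<forall>l y. l > 0 \<and> l *\<^sub>R w + y \<in> C \<and> (\<forall>z\<in>T. l *\<^sub>R z + y \<notin> interior C) \<longrightarrow> r \<le> l"
  obtains l y z where "l > 0" "l *\<^sub>R a + y \<in> C" "l *\<^sub>R c + y \<in> C" "\<And>z. z \<in> T \<Longrightarrow> l *\<^sub>R z + y \<notin> interior C"
    "l *\<^sub>R w + y \<in> interior C" "z \<in> T" "0 < n \<bullet> (z - a)" "l *\<^sub>R z + y \<in> C"
proof -
  define K where "K = {d :: real \<times> (real^2). r \<le> fst d \<and> fst d *\<^sub>R a + snd d \<in> C \<and> fst d *\<^sub>R c + snd d \<in> C \<and>
      (\<forall>z\<in>T. fst d *\<^sub>R z + snd d \<in> - interior C)}"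
  have cont: "continuous_on UNIV (\<lambda>d :: real \<times> (real^2). fst d *\<^sub>R z + snd d)" for z
    by (intro continuous_intros)
  have "K = {d. r \<le> fst d} \<inter> ((\<lambda>d. fst d *\<^sub>R a + snd d) -` C) \<inter> ((\<lambda>d. fst d *\<^sub>R c + snd d) -` C) \<inter>
      (\<Inter>z\<in>T. (\<lambda>d. fst d *\<^sub>R z + snd d) -` (- interior C))"
    by (auto simp: K_def)
  moreover have "closed {d :: real \<times> (real^2). r \<le> fst d}" by (intro closed_Collect_le continuous_intros)
  ultimately have "closed K"
    using closed_vimage[OF closedC cont] closed_vimage[OF _ cont, of "- interior C"]
    by (auto intro!: closed_Int closed_INT)
  moreover have "bounded K"
  proof -
    obtain B where B: "\<And>x. x \<in> C \<Longrightarrow> norm x \<le> B" using compact_imp_bounded[OF compactC] by (auto simp: bounded_iff)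
    define R where "R = 2 * B / norm (c - a)"
    have "K \<subseteq> {0..R} \<times> cball 0 (B + R * norm a)"
    proof
      fix d assume d: "d \<in> K"
      obtain l y where ly: "d = (l, y)" by (cases d)
      have l: "0 < l" "l *\<^sub>R a + y \<in> C" "l *\<^sub>R c + y \<in> C" using d r ly by (auto simp: K_def)
      have "norm (l *\<^sub>R (c - a)) = norm ((l *\<^sub>R c + y) - (l *\<^sub>R a + y))" by (simp add: algebra_simps)
      also have "\<dots> \<le> B + B" using norm_triangle_ineq4 B[OF l(2)] B[OF l(3)] by (meson add_mono order_trans)
      finally have lR: "l \<le> R" using l T by (simp add: R_def pos_le_divide_eq)
      have "norm y = norm ((l *\<^sub>R a + y) - l *\<^sub>R a)" by simp
      also have "\<dots> \<le> norm (l *\<^sub>R a + y) + norm (l *\<^sub>R a)" by (rule norm_triangle_ineq4)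
      also have "\<dots> \<le> B + R * norm a" using B[OF l(2)] l lR by (simp add: add_mono mult_right_mono)
      finally show "d \<in> {0..R} \<times> cball 0 (B + R * norm a)" using l lR ly by simp
    qed
    then show ?thesis by (rule bounded_subset[rotated]) (intro bounded_Times, auto)
  qed
  ultimately have "compact K" by (simp add: compact_eq_bounded_closed)
  have memK: "(l, y) \<in> K \<longleftrightarrow> r \<le> l \<and> l *\<^sub>R a + y \<in> C \<and> l *\<^sub>R c + y \<in> C \<and> (\<forall>z\<in>T. l *\<^sub>R z + y \<notin> interior C)" for l y
    by (auto simp: K_def)
  have dK: "(l, y) \<in> K" unfolding memK using D r(2) int_C[OF w(1)] by blast
  obtain d where dd: "d \<in> K" "\<And>d'. d' \<in> K \<Longrightarrow> n \<bullet> (fst d *\<^sub>R a + snd d) \<le> n \<bullet> (fst d' *\<^sub>R a + snd d')"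
  proof -
    have "continuous_on K (\<lambda>d. n \<bullet> (fst d *\<^sub>R a + snd d))" by (intro continuous_intros)
    then show ?thesis using continuous_attains_inf[OF \<open>compact K\<close>] dK that by blast
  qed
  obtain l1 y1 where ly1: "d = (l1, y1)" by (cases d)
  define u where "u = c - a"
  have u: "u \<noteq> 0" "n \<bullet> u = 0" using T n by (auto simp: u_def)
  have fr: "l *\<^sub>R a + y \<in> frontier C" "l *\<^sub>R a + y + l *\<^sub>R u \<in> frontier C" "l > 0" if "(l, y) \<in> K" for l y
    using that T r by (auto simp: memK frontier_C u_def algebra_simps)
  have K1: "(l1, y1) \<in> K" using dd ly1 by simp
  have le: "n \<bullet> (l1 *\<^sub>R a + y1) \<le> n \<bullet> (l *\<^sub>R a + y)" if "(l, y) \<in> K" for l y using dd(2)[OF that] ly1 by simp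
  have "l *\<^sub>R (w - a) + (l *\<^sub>R a + y) \<in> interior C" using w by (simp add: algebra_simps)
  then have w1: "l1 *\<^sub>R (w - a) + (l1 *\<^sub>R a + y1) \<in> interior C"
    using chord_le_above[OF fr[OF dK] fr[OF K1] u(2,1) n(2) le[OF dK]] w(2) by blast
  have "\<exists>z\<in>T. 0 < n \<bullet> (z - a) \<and> l1 *\<^sub>R z + y1 \<in> C"
  proof (rule ccontr)
    assume no: "\<not> (\<exists>z\<in>T. 0 < n \<bullet> (z - a) \<and> l1 *\<^sub>R z + y1 \<in> C)"
    let ?F = "(\<lambda>z. z - a) ` {z \<in> T. 0 < n \<bullet> (z - a)}"
    obtain l' y' where D': "l' > 0" "y' \<in> frontier C" "y' + l' *\<^sub>R u \<in> frontier C"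
      "n \<bullet> y' < n \<bullet> (l1 *\<^sub>R a + y1)" "\<And>p. p \<in> ?F \<Longrightarrow> l' *\<^sub>R p + y' \<notin> C"
    proof (rule chord_push[OF fr[OF K1] u(2,1) n(2)])
      show "finite ?F" using T by simp
      show "l1 *\<^sub>R p + (l1 *\<^sub>R a + y1) \<notin> C" if "p \<in> ?F" for p using that no by (auto simp: algebra_simps)
    qed blast
    have free: "l' *\<^sub>R (z - a) + y' \<notin> interior C" if z: "z \<in> T" for z
    proof (cases "0 < n \<bullet> (z - a)")
      case True
      then show ?thesis using D'(5) z int_C by blast
    next
      case False
      show ?thesis
      proof
        assume "l' *\<^sub>R (z - a) + y' \<in> interior C"
        then have "l1 *\<^sub>R (z - a) + (l1 *\<^sub>R a + y1) \<in> interior C"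
          using chord_le_below[OF fr[OF K1] D'(2,3,1) u(2,1) n(2)] D'(4) False by simp
        then show False using K1 z by (simp add: memK algebra_simps)
      qed
    qed
    have wi: "l' *\<^sub>R (w - a) + y' \<in> interior C"
      using chord_le_above[OF fr[OF K1] D'(2,3,1) u(2,1) n(2) _ w1] D'(4) w(2) by simp
    have shift: "l' *\<^sub>R x + (y' - l' *\<^sub>R a) = l' *\<^sub>R (x - a) + y'" for x by (simp add: algebra_simps)
    have "r \<le> l'" using r(2)[rule_format, of l' "y' - l' *\<^sub>R a"] D'(1) free int_C[OF wi] by (simp add: shift)
    then have "(l', y' - l' *\<^sub>R a) \<in> K" using D'(2,3) free by (simp add: memK shift frontier_C) (simp add: u_def algebra_simps)
    from le[OF this] D'(4) show False by (simp add: shift)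
  qed
  then obtain z where "z \<in> T" "0 < n \<bullet> (z - a)" "l1 *\<^sub>R z + y1 \<in> C" by blast
  moreover have "l1 *\<^sub>R w + y1 \<in> interior C" using w1 by (simp add: algebra_simps)
  ultimately show ?thesis using that[of l1 y1 z] K1 r by (auto simp: memK)
qed

text \<open>Three stages keep \<open>w\<close> in the interior and the interior free of
  \<open>T\<close>. Scale about \<open>w\<close> until a point \<open>a\<close> of \<open>T\<close>
  lies on the boundary, enlarge about \<open>a\<close> until a second point \<open>c\<close> does,
  then move in the pencil through \<open>a\<close> and \<open>c\<close> until a third one does. The
  bound \<open>r\<close> makes the last two stages stop.\<close>

lemma delaunay_triangle:
  assumes T: "finite T" "T \<noteq> {}" "w \<notin> T"
    and r: "r > 0" "\<forall>l y. l > 0 \<and> l *\<^sub>R w + y \<in> C \<and> (\<forall>z\<in>T. l *\<^sub>R z + y \<notin> interior C) \<longrightarrow> r \<le> l"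
  obtains l y a b c where "l > 0" "\<And>z. z \<in> T \<Longrightarrow> l *\<^sub>R z + y \<notin> interior C" "l *\<^sub>R w + y \<in> interior C"
    "a \<in> T" "b \<in> T" "c \<in> T" "a \<noteq> b" "b \<noteq> c" "a \<noteq> c" "l *\<^sub>R a + y \<in> C" "l *\<^sub>R b + y \<in> C" "l *\<^sub>R c + y \<in> C"
proof -
  obtain y0 where y0: "y0 \<in> interior C" using int_ne by blast
  obtain z0 where z0: "z0 \<in> T" using T by blast
  have small: "\<exists>t>0. y0 + t *\<^sub>R (z0 - w) \<in> interior C"
  proof -
    obtain d where d: "d > 0" "ball y0 d \<subseteq> interior C" using y0 open_contains_ball[of "interior C"] by auto
    have ne: "norm (z0 - w) > 0" using z0 T by auto
    have "dist y0 (y0 + (d / (2 * norm (z0 - w))) *\<^sub>R (z0 - w)) = d / 2" using d ne by (simp add: dist_norm)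
    then have "y0 + (d / (2 * norm (z0 - w))) *\<^sub>R (z0 - w) \<in> interior C" using d by (intro subsetD[OF d(2)]) simp
    then show ?thesis using d ne by (intro exI[of _ "d / (2 * norm (z0 - w))"]) simp
  qed
  then obtain t0 where t0: "t0 > 0" "1 *\<^sub>R (w + t0 *\<^sub>R (z0 - w)) + (y0 - w) \<in> C"
    using int_C by (force simp: algebra_simps)
  obtain t a where ta: "t0 \<le> t" "a \<in> T" "1 *\<^sub>R (w + t *\<^sub>R (a - w)) + (y0 - w) \<in> C"
    "\<And>z. z \<in> T \<Longrightarrow> 1 *\<^sub>R (w + t *\<^sub>R (z - w)) + (y0 - w) \<notin> interior C"
    using rescale[OF zero_less_one T(1,3) z0 t0] by blast
  have t: "t > 0" using t0 ta by simp
  define y1 where "y1 = y0 - t *\<^sub>R w"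
  have eq1: "1 *\<^sub>R (w + t *\<^sub>R (x - w)) + (y0 - w) = t *\<^sub>R x + y1" for x by (simp add: y1_def algebra_simps)
  have D1: "t *\<^sub>R a + y1 \<in> C" "\<And>z. z \<in> T \<Longrightarrow> t *\<^sub>R z + y1 \<notin> interior C" using ta by (simp_all add: eq1[symmetric])
  have w1: "t *\<^sub>R w + y1 \<in> interior C" using y0 by (simp add: y1_def)
  have af: "t *\<^sub>R a + y1 \<in> frontier C" using D1 ta by (simp add: frontier_C)
  \<comment> \<open>Enlarged by this factor, the homothet has parameter \<open>t * s0 < r\<close>
    and is too large to be empty, so some point of \<open>T\<close> is in its interior. The cap at 1
    keeps the original homothet inside, and with it \<open>w\<close>.\<close>
  define s0 where "s0 = min 1 (r / (2 * t))"
  have s0: "0 < s0" "s0 \<le> 1" "t * s0 < r"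
  proof -
    show "0 < s0" "s0 \<le> 1" using r t by (auto simp: s0_def)
    have "t * s0 \<le> t * (r / (2 * t))" using t by (intro mult_left_mono) (auto simp: s0_def)
    also have "\<dots> < r" using t r by simp
    finally show "t * s0 < r" .
  qed
  have eq2: "t *\<^sub>R (a + s *\<^sub>R (x - a)) + y1 = (t * s) *\<^sub>R x + (t *\<^sub>R ((1 - s) *\<^sub>R a) + y1)" for s x
    by (simp add: algebra_simps)
  have comb: "t *\<^sub>R (a + s *\<^sub>R (x - a)) + y1 = (1 - (1 - s)) *\<^sub>R (t *\<^sub>R x + y1) + (1 - s) *\<^sub>R (t *\<^sub>R a + y1)" for s x
    by (simp add: algebra_simps)
  have wI: "t *\<^sub>R (a + s *\<^sub>R (w - a)) + y1 \<in> interior C" if "0 < s" "s \<le> 1" for s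
    unfolding comb using that by (intro int_comb w1 D1) auto
  have "\<exists>z\<in>T. t *\<^sub>R (a + s0 *\<^sub>R (z - a)) + y1 \<in> interior C"
  proof (rule ccontr)
    assume "\<not> ?thesis"
    then have "r \<le> t * s0"
      using r(2)[rule_format, of "t * s0" "t *\<^sub>R ((1 - s0) *\<^sub>R a) + y1"] t s0 int_C[OF wI[OF s0(1,2)]]
      unfolding eq2[symmetric] by simp
    then show False using s0 by simp
  qed
  then obtain z1 where z1: "z1 \<in> T" "t *\<^sub>R (a + s0 *\<^sub>R (z1 - a)) + y1 \<in> interior C" by blast
  have "z1 \<noteq> a" using z1 af by (auto simp: frontier_C)
  obtain s c where sc: "s0 \<le> s" "c \<in> T - {a}" "t *\<^sub>R (a + s *\<^sub>R (c - a)) + y1 \<in> C"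
    "\<And>z. z \<in> T - {a} \<Longrightarrow> t *\<^sub>R (a + s *\<^sub>R (z - a)) + y1 \<notin> interior C"
    using rescale[OF t, of "T - {a}" a z1 s0 y1] T z1 \<open>z1 \<noteq> a\<close> s0 int_C by blast
  have s: "0 < s" using s0 sc by simp
  have "s \<le> 1"
  proof (rule ccontr)
    assume "\<not> s \<le> 1"
    have "(t *\<^sub>R a + y1) + t *\<^sub>R (c - a) = t *\<^sub>R c + y1" by (simp add: algebra_simps)
    moreover have "(t *\<^sub>R a + y1) + t *\<^sub>R (c - a) \<in> interior C"
    proof (rule between_int[of _ 0 _ "t * s"])
      show "t *\<^sub>R a + y1 + (t * s) *\<^sub>R (c - a) \<in> C" using sc(3) by (simp add: algebra_simps)
    qed (use D1 sc t \<open>\<not> s \<le> 1\<close> in auto)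
    ultimately have "t *\<^sub>R c + y1 \<in> interior C" by metis
    then show False using D1(2)[of c] sc(2) by blast
  qed
  define l2 where "l2 = t * s"
  define y2 where "y2 = t *\<^sub>R ((1 - s) *\<^sub>R a) + y1"
  note e2 = eq2[of s, folded l2_def y2_def]
  have l2: "l2 > 0" using t s by (simp add: l2_def)
  have T2: "l2 *\<^sub>R z + y2 \<notin> interior C" if "z \<in> T" for z
    using sc(4)[of z] that D1(2)[OF ta(2)] by (cases "z = a") (auto simp flip: e2)
  have a2: "l2 *\<^sub>R a + y2 \<in> C" using D1 by (simp flip: e2)
  have c2: "l2 *\<^sub>R c + y2 \<in> C" using sc by (simp flip: e2)
  have w2: "l2 *\<^sub>R w + y2 \<in> interior C" using wI[OF s \<open>s \<le> 1\<close>] by (simp flip: e2)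
  have ac: "a \<noteq> c" "c \<in> T" using sc by auto
  define n where "n = (if 0 \<le> perp (c - a) \<bullet> (w - a) then perp (c - a) else - perp (c - a))"
  have n: "n \<bullet> (c - a) = 0" "n \<noteq> 0" "0 \<le> n \<bullet> (w - a)" using ac by (auto simp: n_def)
  obtain l y z where fin: "l > 0" "l *\<^sub>R a + y \<in> C" "l *\<^sub>R c + y \<in> C" "\<And>z. z \<in> T \<Longrightarrow> l *\<^sub>R z + y \<notin> interior C"
    "l *\<^sub>R w + y \<in> interior C" "z \<in> T" "0 < n \<bullet> (z - a)" "l *\<^sub>R z + y \<in> C"
    using delaunay_push[OF T(1) ta(2) ac(2,1) n(1,2) l2 a2 c2 T2 w2 n(3) r] by blast
  have "z \<noteq> a" "z \<noteq> c" using fin(7) n by auto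
  then show ?thesis using that[of l y a c z] fin ac ta(2) by auto
qed

section \<open>Illumination of the body and counting of slots\<close>

text \<open>Take a leftmost point \<open>p\<close> and a rightmost point \<open>q\<close>. The
  directions \<open>q - p\<close> and \<open>p - q\<close> illuminate these two, and any other point
  lies on a vertical line through an interior point of the chord from \<open>p\<close> to
  \<open>q\<close>, so \<open>e\<close> or \<open>- e\<close> works. Excluding 0 ensures that large
  multiples of the directions are far away.\<close>

lemma illumination:
  "\<exists>Q. finite Q \<and> card Q \<le> 4 \<and> 0 \<notin> Q \<and> (\<forall>y\<in>C. \<exists>q\<in>Q. \<exists>s>0. y + s *\<^sub>R q \<in> interior C)"
proof -
  define e :: "real^2" where "e = axis 2 1"
  have e: "e$1 = 0" "e$2 = 1" by (auto simp: e_def axis_def)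
  have cont: "continuous_on C (\<lambda>x. x$1)" by (intro continuous_intros)
  have Cne: "C \<noteq> {}" using int_ne interior_subset by blast
  obtain p where p: "p \<in> C" "\<And>x. x \<in> C \<Longrightarrow> p$1 \<le> x$1" using continuous_attains_inf[OF compactC Cne cont] by blast
  obtain q where q: "q \<in> C" "\<And>x. x \<in> C \<Longrightarrow> x$1 \<le> q$1" using continuous_attains_sup[OF compactC Cne cont] by blast
  have strict_ineq: "p$1 < x$1" "x$1 < q$1" if x: "x \<in> interior C" for x
  proof -
    obtain d where d: "d > 0" "ball x d \<subseteq> interior C" using x open_contains_ball[of "interior C"] by auto
    have nrm: "norm ((d/2) *\<^sub>R (axis 1 1 :: real^2)) < d" using d by simp
    have "x + (d/2) *\<^sub>R axis 1 1 \<in> C" "x - (d/2) *\<^sub>R axis 1 1 \<in> C"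
      using nrm by (auto intro!: int_C subsetD[OF d(2)] simp: dist_norm)
    then have "(x + (d/2) *\<^sub>R axis 1 1)$1 \<le> q$1" "p$1 \<le> (x - (d/2) *\<^sub>R axis 1 1)$1" using p q by blast+
    then show "p$1 < x$1" "x$1 < q$1" using d by (auto simp: axis_def)
  qed
  have pq: "p$1 < q$1" using strict_ineq int_ne by (metis ex_in_conv less_trans)
  then have "p \<noteq> q" by auto
  have half: "x + (1/2) *\<^sub>R (y - x) \<in> interior C" if "x \<in> C" "y \<in> C" "x \<noteq> y" for x y
  proof -
    have "x + (1/2) *\<^sub>R (y - x) = (1 - 1/2) *\<^sub>R x + (1/2) *\<^sub>R y"
      by (simp add: vec_eq_iff field_simps)
    then show ?thesis using strict[OF that, of "1/2"] by simp
  qed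
  let ?Q = "{e, - e, q - p, p - q}"
  have "\<exists>d\<in>?Q. \<exists>s>0. y + s *\<^sub>R d \<in> interior C" if y: "y \<in> C" for y
  proof -
    consider "y = p" | "y = q" | "y \<noteq> p" "y \<noteq> q" by blast
    then show ?thesis
    proof cases
      case 1
      then have "y + (1/2) *\<^sub>R (q - p) \<in> interior C" using half[OF p(1) q(1)] \<open>p \<noteq> q\<close> by simp
      moreover have "(1/2::real) > 0" by simp
      ultimately show ?thesis by blast
    next
      case 2
      then have "y + (1/2) *\<^sub>R (p - q) \<in> interior C" using half[OF q(1) p(1)] \<open>p \<noteq> q\<close> by simp
      moreover have "(1/2::real) > 0" by simp
      ultimately show ?thesis by blast
    next
      case 3
      have "p$1 < (y + (1/2) *\<^sub>R (p - y))$1" "(y + (1/2) *\<^sub>R (q - y))$1 < q$1"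
        using strict_ineq half[OF y p(1)] half[OF y q(1)] 3 by blast+
      then have yy: "p$1 < y$1" "y$1 < q$1" by (auto simp: field_simps)
      define t where "t = (y$1 - p$1) / (q$1 - p$1)"
      have t: "0 < t" "t < 1" using yy by (auto simp: t_def)
      define x where "x = (1 - t) *\<^sub>R p + t *\<^sub>R q"
      have xi: "x \<in> interior C" unfolding x_def by (rule strict[OF p(1) q(1) \<open>p \<noteq> q\<close> t])
      have "t * (q$1 - p$1) = y$1 - p$1" using pq by (simp add: t_def)
      then have "x$1 = y$1" by (simp add: x_def algebra_simps)
      then have xy: "x = y + (x$2 - y$2) *\<^sub>R e" using e by (simp add: vec_eq_iff forall_2)
      consider "0 < x$2 - y$2" | "x$2 - y$2 < 0" | "x = y" using xy by (cases "x$2" "y$2" rule: linorder_cases) auto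
      then show ?thesis
      proof cases
        case 1
        then show ?thesis using xi xy by (metis insertI1)
      next
        case 2
        have "y + (y$2 - x$2) *\<^sub>R (- e) = x" using xy by (simp add: algebra_simps)
        then show ?thesis using xi 2 by (metis insertI1 insertI2 diff_gt_0_iff_gt diff_less_0_iff_less)
      next
        case 3
        obtain d where d: "d > 0" "ball x d \<subseteq> interior C" using xi open_contains_ball[of "interior C"] by auto
        have "x + (d/2) *\<^sub>R e \<in> interior C" using d by (auto intro!: subsetD[OF d(2)] simp: dist_norm e_def)
        then show ?thesis using d 3 by (intro bexI[of _ e] exI[of _ "d/2"]) auto
      qed
    qed
  qed
  moreover have "card (set [e, - e, q - p, p - q]) \<le> 4" by (rule order_trans[OF card_length]) simp
  then have "card ?Q \<le> 4" by (simp only: list.set)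
  moreover have "0 \<notin> ?Q" using \<open>p \<noteq> q\<close> by (auto simp: e_def axis_eq_0_iff)
  ultimately show ?thesis by (intro exI[of _ ?Q]) blast
qed

text \<open>Each illuminating direction tolerates small changes of the point and of the direction,
  and works for all short steps by convexity. A finite subcover of the compact \<open>C\<close>
  gives one tolerance for all points.\<close>

lemma uniform_illumination:
  assumes Q: "\<And>y. y \<in> C \<Longrightarrow> \<exists>q\<in>Q. \<exists>s>0. y + s *\<^sub>R q \<in> interior C"
  obtains \<epsilon> where "\<epsilon> > 0"
    "\<And>y. y \<in> C \<Longrightarrow> \<exists>q\<in>Q. \<forall>s v. 0 < s \<and> s \<le> \<epsilon> \<and> norm v \<le> \<epsilon> \<longrightarrow> y + s *\<^sub>R (q + v) \<in> interior C"
proof -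
  have "\<exists>d>0. \<exists>q\<in>Q. \<forall>x s v. x \<in> C \<and> x \<in> ball y d \<and> 0 < s \<and> s \<le> d \<and> norm v \<le> d \<longrightarrow> x + s *\<^sub>R (q + v) \<in> interior C"
    if y: "y \<in> C" for y
  proof -
    obtain q s0 where q: "q \<in> Q" "s0 > 0" "y + s0 *\<^sub>R q \<in> interior C" using Q[OF y] by blast
    obtain r where r: "r > 0" "ball (y + s0 *\<^sub>R q) r \<subseteq> interior C"
      using q open_contains_ball[of "interior C"] by auto
    \<comment> \<open>The three bounds control the shift of the base point, the step length, and the
      direction error after a step of length \<open>s0\<close>; the total error stays below
      \<open>r\<close>.\<close>
    define d where "d = min (r / 2) (min s0 (r / (3 * s0)))"
    have d: "0 < d" "d \<le> r / 2" "d \<le> s0" "d * s0 < r / 2"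
    proof -
      show "0 < d" "d \<le> r / 2" "d \<le> s0" using r q by (auto simp: d_def)
      have "d * s0 \<le> r / (3 * s0) * s0" using q by (intro mult_right_mono) (auto simp: d_def)
      then show "d * s0 < r / 2" using q r by simp
    qed
    have "x + s *\<^sub>R (q + v) \<in> interior C" if x: "x \<in> C" "x \<in> ball y d" "0 < s" "s \<le> d" "norm v \<le> d" for x s v
    proof -
      have "norm (s0 *\<^sub>R v) \<le> d * s0" using x q by (simp add: mult.commute mult_right_mono)
      moreover have "dist (y + s0 *\<^sub>R q) (x + s0 *\<^sub>R (q + v)) \<le> norm (y - x) + norm (s0 *\<^sub>R v)"
        using norm_triangle_ineq4[of "y - x" "s0 *\<^sub>R v"] by (simp add: dist_norm algebra_simps)
      moreover have "norm (y - x) < d" using x by (simp add: dist_norm)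
      ultimately have "dist (y + s0 *\<^sub>R q) (x + s0 *\<^sub>R (q + v)) < r" using d by linarith
      then have "x + s0 *\<^sub>R (q + v) \<in> interior C" by (intro subsetD[OF r(2)]) simp
      from int_comb[OF this x(1), of "1 - s / s0"] have "(s / s0) *\<^sub>R (x + s0 *\<^sub>R (q + v)) + (1 - s / s0) *\<^sub>R x \<in> interior C"
        using x d q by simp
      moreover have "(s / s0) *\<^sub>R (x + s0 *\<^sub>R (q + v)) + (1 - s / s0) *\<^sub>R x = x + s *\<^sub>R (q + v)"
        using q by (simp add: algebra_simps)
      ultimately show ?thesis by simp
    qed
    then show ?thesis using d q by blast
  qed
  then obtain d where d: "\<And>y. y \<in> C \<Longrightarrow> d y > 0"
    "\<And>y. y \<in> C \<Longrightarrow> \<exists>q\<in>Q. \<forall>x s v. x \<in> C \<and> x \<in> ball y (d y) \<and> 0 < s \<and> s \<le> d y \<and> norm v \<le> d y \<longrightarrow> x + s *\<^sub>R (q + v) \<in> interior C"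
    by metis
  obtain Y where Y: "Y \<subseteq> C" "finite Y" "C \<subseteq> (\<Union>y\<in>Y. ball y (d y))"
  proof (rule compactE_image[OF compactC, of C "\<lambda>y. ball y (d y)"])
    show "C \<subseteq> (\<Union>y\<in>C. ball y (d y))" using d(1) by fastforce
  qed auto
  have Yne: "Y \<noteq> {}" using Y int_ne interior_subset[of C] by auto
  define \<epsilon> where "\<epsilon> = Min (d ` Y)"
  show ?thesis
  proof
    show "\<epsilon> > 0" unfolding \<epsilon>_def using Y Yne d(1) by (subst Min_gr_iff) auto
    fix x assume x: "x \<in> C"
    then obtain y where y: "y \<in> Y" "x \<in> ball y (d y)" using Y by blast
    have "\<epsilon> \<le> d y" unfolding \<epsilon>_def using Y y by simp
    moreover obtain q where "q \<in> Q" "\<forall>x s v. x \<in> C \<and> x \<in> ball y (d y) \<and> 0 < s \<and> s \<le> d y \<and> norm v \<le> d y \<longrightarrow> x + s *\<^sub>R (q + v) \<in> interior C"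
      using d(2) y Y by blast
    ultimately show "\<exists>q\<in>Q. \<forall>s v. 0 < s \<and> s \<le> \<epsilon> \<and> norm v \<le> \<epsilon> \<longrightarrow> x + s *\<^sub>R (q + v) \<in> interior C"
      using x y by (meson order_trans)
  qed
qed

text \<open>A slot \<open>(b, \<plusminus>1)\<close> records the middle vertex \<open>b\<close> (with respect to the direction orthogonal to \<open>d\<close>) of a
  Delaunay triangle of \<open>T\<close> whose circumscribed homothet contains \<open>w\<close>, and on which side of \<open>b\<close>, along \<open>\<plusminus>d\<close>,
  that triangle lies.\<close>
definition slot :: "(real^2) set \<Rightarrow> real^2 \<Rightarrow> real^2 \<Rightarrow> (real^2) \<times> real \<Rightarrow> bool" where
  "slot T d w bs \<longleftrightarrow> (\<exists>l y a c \<alpha> \<beta>. l > 0 \<and> (\<forall>z\<in>T. l *\<^sub>R z + y \<notin> interior C) \<and> l *\<^sub>R w + y \<in> interior C \<and>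
     a \<in> T \<and> c \<in> T \<and> a \<noteq> fst bs \<and> c \<noteq> fst bs \<and> a \<noteq> c \<and>
     l *\<^sub>R a + y \<in> C \<and> l *\<^sub>R fst bs + y \<in> C \<and> l *\<^sub>R c + y \<in> C \<and> \<alpha> > 0 \<and> \<beta> > 0 \<and>
     \<alpha> *\<^sub>R (a - fst bs) + \<beta> *\<^sub>R (c - fst bs) = snd bs *\<^sub>R d)"

text \<open>Sort the Delaunay triangle by abscissa. The line through the middle vertex
  \<open>b'\<close> in direction \<open>perp \<kappa>\<close> meets the opposite side at
  \<open>b' + q\<close>, and the sign of \<open>h\<close> tells on which side. If \<open>h\<close>
  were 0, \<open>b'\<close> would lie inside a chord and hence in the interior of an empty
  homothet.\<close>

lemma slot_exists:
  assumes T: "finite T" "T \<noteq> {}" "w \<notin> T"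
    and r: "r > 0" "\<forall>l y. l > 0 \<and> l *\<^sub>R w + y \<in> C \<and> (\<forall>z\<in>T. l *\<^sub>R z + y \<notin> interior C) \<longrightarrow> r \<le> l"
    and \<kappa>: "\<kappa> \<noteq> 0" "inj_on (\<lambda>p. \<kappa> \<bullet> p) T"
  shows "\<exists>bs \<in> T \<times> {1, -1}. slot T (perp \<kappa>) w bs"
proof -
  obtain l y a b c where D: "l > 0" "\<And>z. z \<in> T \<Longrightarrow> l *\<^sub>R z + y \<notin> interior C" "l *\<^sub>R w + y \<in> interior C"
    "a \<in> T" "b \<in> T" "c \<in> T" "a \<noteq> b" "b \<noteq> c" "a \<noteq> c" "l *\<^sub>R a + y \<in> C" "l *\<^sub>R b + y \<in> C" "l *\<^sub>R c + y \<in> C"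
    using delaunay_triangle[OF T r] by blast
  obtain a' b' c' where s: "{a', b', c'} = {a, b, c}" "\<kappa> \<bullet> a' < \<kappa> \<bullet> b'" "\<kappa> \<bullet> b' < \<kappa> \<bullet> c'"
    using sort_three[OF \<kappa>(2) D(4-9)] by blast
  have "\<forall>x\<in>{a, b, c}. x \<in> T \<and> l *\<^sub>R x + y \<in> C" using D by simp
  then have m: "a' \<in> T" "b' \<in> T" "c' \<in> T" "l *\<^sub>R a' + y \<in> C" "l *\<^sub>R b' + y \<in> C" "l *\<^sub>R c' + y \<in> C"
    unfolding s(1)[symmetric] by auto
  define \<theta> where "\<theta> = (\<kappa> \<bullet> b' - \<kappa> \<bullet> a') / (\<kappa> \<bullet> c' - \<kappa> \<bullet> a')"
  have \<theta>: "0 < \<theta>" "\<theta> < 1" using s by (auto simp: \<theta>_def)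
  define q where "q = (1 - \<theta>) *\<^sub>R (a' - b') + \<theta> *\<^sub>R (c' - b')"
  have "\<theta> * (\<kappa> \<bullet> c' - \<kappa> \<bullet> a') = \<kappa> \<bullet> b' - \<kappa> \<bullet> a'" using s by (simp add: \<theta>_def)
  then have "\<kappa> \<bullet> q = 0" by (simp add: q_def inner_simps algebra_simps)
  moreover have "\<kappa> \<bullet> perp \<kappa> = 0" using inner_perp[of \<kappa>] by (simp add: inner_commute)
  ultimately obtain h where h: "q = h *\<^sub>R perp \<kappa>"
    using plane_orthogonal_multiple[of \<kappa> "perp \<kappa>" q] \<kappa> by auto
  have "h \<noteq> 0"
  proof
    assume "h = 0"
    then have q0: "q = 0" using h by simp
    have "(1 - \<theta>) *\<^sub>R (l *\<^sub>R a' + y) + \<theta> *\<^sub>R (l *\<^sub>R c' + y) = l *\<^sub>R q + (l *\<^sub>R b' + y)"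
      by (simp add: q_def algebra_simps)
    moreover have "l *\<^sub>R a' + y \<noteq> l *\<^sub>R c' + y" using s D(1) by auto
    ultimately have "l *\<^sub>R b' + y \<in> interior C" using strict[OF m(4,6) _ \<theta>] q0 by simp
    then show False using D(2) m by blast
  qed
  have eq: "((1 - \<theta>) / \<bar>h\<bar>) *\<^sub>R (a' - b') + (\<theta> / \<bar>h\<bar>) *\<^sub>R (c' - b') = sgn h *\<^sub>R perp \<kappa>"
  proof -
    have "((1 - \<theta>) / \<bar>h\<bar>) *\<^sub>R (a' - b') + (\<theta> / \<bar>h\<bar>) *\<^sub>R (c' - b') = (1 / \<bar>h\<bar>) *\<^sub>R q"
      by (simp add: q_def scaleR_add_right)
    then show ?thesis using h \<open>h \<noteq> 0\<close> by (simp add: sgn_if)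
  qed
  have "slot T (perp \<kappa>) w (b', sgn h)"
    unfolding slot_def fst_conv snd_conv
  proof (intro exI conjI)
    show "((1 - \<theta>) / \<bar>h\<bar>) *\<^sub>R (a' - b') + (\<theta> / \<bar>h\<bar>) *\<^sub>R (c' - b') = sgn h *\<^sub>R perp \<kappa>" by (rule eq)
    show "l > 0" "\<forall>z\<in>T. l *\<^sub>R z + y \<notin> interior C" "l *\<^sub>R w + y \<in> interior C" using D by auto
  qed (use m s \<theta> \<open>h \<noteq> 0\<close> in auto)
  moreover have "(b', sgn h) \<in> T \<times> {1, -1}" using m \<open>h \<noteq> 0\<close> by (auto simp: sgn_if)
  ultimately show ?thesis by blast
qed

text \<open>The coordinate change \<open>g\<close> turns the first homothet into \<open>C\<close>
  itself and the second into the one with parameters \<open>k\<close> and \<open>z\<close>. Both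
  triangles contain the germ of the same ray at \<open>b\<close>, so the two homothets
  coincide.\<close>

lemma slot_same_homothet:
  assumes "slot T d w (b, s)" "slot T d w' (b, s)" "b \<in> T"
  obtains l y where "l > 0" "\<And>z. z \<in> T \<Longrightarrow> l *\<^sub>R z + y \<notin> interior C"
    "l *\<^sub>R w + y \<in> interior C" "l *\<^sub>R w' + y \<in> interior C"
proof -
  obtain l y a c \<alpha> \<beta> where D: "l > 0" "\<forall>z\<in>T. l *\<^sub>R z + y \<notin> interior C" "l *\<^sub>R w + y \<in> interior C"
    "a \<in> T" "c \<in> T" "a \<noteq> b" "c \<noteq> b" "a \<noteq> c" "l *\<^sub>R a + y \<in> C" "l *\<^sub>R b + y \<in> C" "l *\<^sub>R c + y \<in> C"
    "\<alpha> > 0" "\<beta> > 0" "\<alpha> *\<^sub>R (a - b) + \<beta> *\<^sub>R (c - b) = s *\<^sub>R d"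
    using assms(1) unfolding slot_def by auto
  obtain l' y' a' c' \<alpha>' \<beta>' where D': "l' > 0" "\<forall>z\<in>T. l' *\<^sub>R z + y' \<notin> interior C" "l' *\<^sub>R w' + y' \<in> interior C"
    "a' \<in> T" "c' \<in> T" "a' \<noteq> b" "c' \<noteq> b" "a' \<noteq> c'" "l' *\<^sub>R a' + y' \<in> C" "l' *\<^sub>R b + y' \<in> C" "l' *\<^sub>R c' + y' \<in> C"
    "\<alpha>' > 0" "\<beta>' > 0" "\<alpha>' *\<^sub>R (a' - b) + \<beta>' *\<^sub>R (c' - b) = s *\<^sub>R d"
    using assms(2) unfolding slot_def by auto
  define g where "g x = l *\<^sub>R x + y" for x
  define k where "k = l' / l"
  define z where "z = y' - k *\<^sub>R y"
  have k: "k > 0" using D D' by (simp add: k_def)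
  have kg: "k *\<^sub>R g x + z = l' *\<^sub>R x + y'" for x
    using D(1) by (simp add: k_def z_def g_def algebra_simps)
  have diff: "g x - g b = l *\<^sub>R (x - b)" for x by (simp add: g_def algebra_simps)
  have inj: "g x \<noteq> g x'" if "x \<noteq> x'" for x x' using that D(1) by (simp add: g_def)
  have fr: "g x \<in> frontier C" if "x \<in> T" "l *\<^sub>R x + y \<in> C" for x using that D(2) by (simp add: g_def frontier_C)
  have fr': "k *\<^sub>R g x + z \<in> frontier C" if "x \<in> T" "l' *\<^sub>R x + y' \<in> C" for x using that D'(2) by (simp add: kg frontier_C)
  have ni: "g x \<notin> interior C" "k *\<^sub>R g x + z \<notin> interior C" if "x \<in> T" for x
    using that D(2) D'(2) by (simp_all add: kg) (simp add: g_def)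
  have sum: "\<alpha> *\<^sub>R (g a - g b) + \<beta> *\<^sub>R (g c - g b) = \<alpha>' *\<^sub>R (g a' - g b) + \<beta>' *\<^sub>R (g c' - g b)"
  proof -
    have "\<alpha> *\<^sub>R (g a - g b) + \<beta> *\<^sub>R (g c - g b) = l *\<^sub>R (\<alpha> *\<^sub>R (a - b) + \<beta> *\<^sub>R (c - b))"
      unfolding diff by (simp only: scaleR_add_right scaleR_scaleR mult.commute)
    also have "\<dots> = l *\<^sub>R (\<alpha>' *\<^sub>R (a' - b) + \<beta>' *\<^sub>R (c' - b))" using D(14) D'(14) by simp
    also have "\<dots> = \<alpha>' *\<^sub>R (g a' - g b) + \<beta>' *\<^sub>R (g c' - g b)"
      unfolding diff by (simp only: scaleR_add_right scaleR_scaleR mult.commute)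
    finally show ?thesis .
  qed
  have "k = 1 \<and> z = 0"
    by (rule homothet_germ_unique[OF k fr[OF assms(3) D(10)] fr'[OF assms(3) D'(10)] fr[OF D(4,9)] fr[OF D(5,11)]
        inj[OF D(6)] inj[OF D(7)] inj[OF D(8)] ni(2)[OF D(4)] ni(2)[OF D(5)] fr'[OF D'(4,9)] fr'[OF D'(5,11)]
        ni(1)[OF D'(4)] ni(1)[OF D'(5)] inj[OF D'(6)] D(12,13) D'(12,13) sum])
  then have "l' = l" "y' = y" using D(1) by (auto simp: k_def z_def)
  then show ?thesis using that[of l y] D D' by blast
qed

text \<open>The four illuminating directions, scaled far away and added to \<open>T\<close>, bound the size of all empty
  homothets containing a point of \<open>W\<close>; they account for the constant 8.\<close>
lemma card_separated_by_empty_homothets: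
  assumes T: "finite T" and W: "finite W" "W \<inter> T = {}"
    and sep: "\<And>l y w w'. \<lbrakk>l > 0; w \<in> W; w' \<in> W; w \<noteq> w'; l *\<^sub>R w + y \<in> C; l *\<^sub>R w' + y \<in> C\<rbrakk>
      \<Longrightarrow> \<exists>z\<in>T. l *\<^sub>R z + y \<in> C"
  shows "card W \<le> 2 * card T + 8"
proof -
  obtain Q where Q: "finite Q" "card Q \<le> 4" "0 \<notin> Q" "\<And>y. y \<in> C \<Longrightarrow> \<exists>q\<in>Q. \<exists>s>0. y + s *\<^sub>R q \<in> interior C"
    using illumination by blast
  obtain \<epsilon> where e: "\<epsilon> > 0"
    "\<And>y. y \<in> C \<Longrightarrow> \<exists>q\<in>Q. \<forall>s v. 0 < s \<and> s \<le> \<epsilon> \<and> norm v \<le> \<epsilon> \<longrightarrow> y + s *\<^sub>R (q + v) \<in> interior C"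
    using uniform_illumination[OF Q(4)] by blast
  obtain B where B: "\<And>w. w \<in> W \<Longrightarrow> norm w \<le> B" using finite_imp_bounded[OF W(1)] by (auto simp: bounded_iff)
  obtain \<delta> where \<delta>: "\<delta> > 0" "\<And>q. q \<in> Q \<Longrightarrow> \<delta> \<le> norm q"
  proof (cases "Q = {}")
    case True
    then show ?thesis using that[of 1] by simp
  next
    case False
    show ?thesis using that[of "Min (norm ` Q)"] False Q by (auto simp: Min_gr_iff)
  qed
  \<comment> \<open>\<open>B \<le> M * \<epsilon>\<close> makes the direction error
    \<open>(1 / M) *\<^sub>R w\<close> admissible for the illumination, and
    \<open>B < M * \<delta>\<close> keeps the far points away from \<open>W\<close>.\<close>
  define M where "M = max 1 (max (B / \<epsilon>) ((B + 1) / \<delta>))"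
  have M: "M > 0" "B \<le> M * \<epsilon>" "B < M * \<delta>"
  proof -
    show "M > 0" by (simp add: M_def)
    have "B / \<epsilon> \<le> M" by (simp add: M_def)
    then show "B \<le> M * \<epsilon>" using e by (simp add: field_simps)
    have "(B + 1) / \<delta> \<le> M" by (simp add: M_def)
    then show "B < M * \<delta>" using \<delta> by (simp add: field_simps)
  qed
  define T' where "T' = T \<union> (\<lambda>q. M *\<^sub>R q) ` Q"
  have finT: "finite T'" using T Q by (simp add: T'_def)
  have cardT: "card T' \<le> card T + 4"
    unfolding T'_def using card_Un_le[of T "(\<lambda>q. M *\<^sub>R q) ` Q"] card_image_le[OF Q(1), of "\<lambda>q. M *\<^sub>R q"] Q(2) by linarith
  have WT: "w \<notin> T'" if "w \<in> W" for w
  proof -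
    have "M *\<^sub>R q \<noteq> w" if "q \<in> Q" for q
    proof
      assume "M *\<^sub>R q = w"
      then have "M * norm q \<le> B" using B[OF \<open>w \<in> W\<close>] M by auto
      moreover have "M * \<delta> \<le> M * norm q" using \<delta>(2)[OF that] M by simp
      ultimately show False using M by linarith
    qed
    then show ?thesis using that W by (auto simp: T'_def)
  qed
  have "\<exists>q. q \<in> Q" using e(2) int_ne int_C by blast
  then have Tne: "T' \<noteq> {}" by (auto simp: T'_def)
  define r where "r = \<epsilon> / M"
  have r: "r > 0" using e M by (simp add: r_def)
  have bound: "r \<le> l" if w: "w \<in> W" and D: "l > 0" "l *\<^sub>R w + y \<in> C" "\<forall>z\<in>T'. l *\<^sub>R z + y \<notin> interior C" for w l y
  proof (rule ccontr)
    assume "\<not> r \<le> l"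
    \<comment> \<open>In a homothet this large, a step of length parameter \<open>l * M\<close> from
      the image of \<open>w\<close> leads exactly to the image of the far point
      \<open>M *\<^sub>R q\<close>. By illumination that image is interior, against
      emptiness.\<close>
    then have lM: "l * M \<le> \<epsilon>" using M by (simp add: r_def field_simps)
    obtain q where q: "q \<in> Q" "\<forall>s v. 0 < s \<and> s \<le> \<epsilon> \<and> norm v \<le> \<epsilon> \<longrightarrow> l *\<^sub>R w + y + s *\<^sub>R (q + v) \<in> interior C"
      using e(2)[OF D(2)] by blast
    have "norm (- ((1 / M) *\<^sub>R w)) \<le> \<epsilon>" using B[OF w] M by (simp add: field_simps)
    then have "l *\<^sub>R w + y + (l * M) *\<^sub>R (q + - ((1 / M) *\<^sub>R w)) \<in> interior C" 
      by (intro q(2)[rule_format]) (use lM D(1) M(1) in auto)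
    moreover have "l *\<^sub>R w + y + (l * M) *\<^sub>R (q + - ((1 / M) *\<^sub>R w)) = l *\<^sub>R (M *\<^sub>R q) + y"
      using M by (simp add: algebra_simps)
    ultimately have "l *\<^sub>R (M *\<^sub>R q) + y \<in> interior C" by metis
    moreover have "M *\<^sub>R q \<in> T'" using q(1) unfolding T'_def by blast
    ultimately show False using D(3) by blast
  qed
  obtain \<kappa> where \<kappa>: "\<kappa> \<noteq> 0" "inj_on (\<lambda>p. \<kappa> \<bullet> p) T'" using inj_on_inner_generic[OF finT] by blast
  have "\<forall>w\<in>W. \<exists>bs \<in> T' \<times> {1, -1}. slot T' (perp \<kappa>) w bs"
    using slot_exists[OF finT Tne WT r _ \<kappa>] bound by blast
  then obtain f where f: "\<And>w. w \<in> W \<Longrightarrow> f w \<in> T' \<times> {1, -1}" "\<And>w. w \<in> W \<Longrightarrow> slot T' (perp \<kappa>) w (f w)"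
    by metis
  have "inj_on f W"
  proof (rule inj_onI, rule ccontr)
    fix w w' assume w: "w \<in> W" "w' \<in> W" "f w = f w'" "w \<noteq> w'"
    obtain b s where bs: "f w = (b, s)" by (cases "f w")
    have bT: "b \<in> T'" using f(1)[OF w(1)] bs by simp
    obtain l y where D: "l > 0" "\<And>z. z \<in> T' \<Longrightarrow> l *\<^sub>R z + y \<notin> interior C"
      "l *\<^sub>R w + y \<in> interior C" "l *\<^sub>R w' + y \<in> interior C"
      using slot_same_homothet[of T' "perp \<kappa>" w b s w'] f(2)[OF w(1)] f(2)[OF w(2)] bs w(3) bT by metis
    \<comment> \<open>Shrinking slightly about \<open>w\<close> keeps \<open>w'\<close> inside. The
      shrunk closed homothet still contains \<open>w\<close> and \<open>w'\<close>, hence by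
      \<open>sep\<close> a point of \<open>T\<close>, which must lie in the interior of the original
      homothet.\<close>
    obtain t where t: "t > 1" "l *\<^sub>R (w + t *\<^sub>R (w' - w)) + y \<in> C"
    proof -
      have "continuous_on UNIV (\<lambda>t::real. l *\<^sub>R (w + t *\<^sub>R (w' - w)) + y)" by (intro continuous_intros)
      then have "open ((\<lambda>t::real. l *\<^sub>R (w + t *\<^sub>R (w' - w)) + y) -` interior C)" by (rule open_vimage[OF open_interior])
      moreover have "1 \<in> (\<lambda>t::real. l *\<^sub>R (w + t *\<^sub>R (w' - w)) + y) -` interior C" using D(4) by simp
      ultimately obtain d where d: "d > 0" "ball 1 d \<subseteq> (\<lambda>t::real. l *\<^sub>R (w + t *\<^sub>R (w' - w)) + y) -` interior C"
        using open_contains_ball by blast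
      have "1 + d / 2 \<in> ball 1 d" using d by (simp add: dist_norm)
      then show ?thesis using that[of "1 + d / 2"] d int_C by auto
    qed
    have eq: "l *\<^sub>R (w + t *\<^sub>R (x - w)) + y = (l * t) *\<^sub>R x + (l *\<^sub>R ((1 - t) *\<^sub>R w) + y)" for x
      by (simp add: algebra_simps)
    have "l *\<^sub>R (w + t *\<^sub>R (w - w)) + y \<in> C" using D(3) int_C by simp
    then have "(l * t) *\<^sub>R w + (l *\<^sub>R ((1 - t) *\<^sub>R w) + y) \<in> C" unfolding eq .
    moreover have "(l * t) *\<^sub>R w' + (l *\<^sub>R ((1 - t) *\<^sub>R w) + y) \<in> C" using t(2) unfolding eq .
    moreover have "l * t > 0" using D(1) t(1) by simp
    ultimately obtain z where z: "z \<in> T" "(l * t) *\<^sub>R z + (l *\<^sub>R ((1 - t) *\<^sub>R w) + y) \<in> C"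
      using sep[OF _ w(1,2,4)] by blast
    have "l *\<^sub>R z + y = (1 - 1 / t) *\<^sub>R (l *\<^sub>R w + y) + (1 / t) *\<^sub>R (l *\<^sub>R (w + t *\<^sub>R (z - w)) + y)"
    proof -
      have "l * z$i + y$i = (1 - 1 / t) * (l * w$i + y$i) + (1 / t) * (l * (w$i + t * (z$i - w$i)) + y$i)" for i
        using t(1) by (simp add: field_simps)
      then show ?thesis by (simp add: vec_eq_iff)
    qed
    moreover have "l *\<^sub>R (w + t *\<^sub>R (z - w)) + y \<in> C" using z(2) unfolding eq .
    ultimately have "l *\<^sub>R z + y \<in> interior C" using int_comb[OF D(3), of _ "1 / t"] t(1) by simp
    then show False using D(2) z by (simp add: T'_def)
  qed
  moreover have "f ` W \<subseteq> T' \<times> {1, -1}" using f(1) by blast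
  ultimately have "card W \<le> card (T' \<times> {1, -1::real})"
    using finT by (intro card_inj_on_le) auto
  also have "\<dots> = 2 * card T'" by (simp add: card_cartesian_product)
  finally show ?thesis using cardT by simp
qed

end

section \<open>From the definitions to the covering bound\<close>

text \<open>If a point \<open>?z\<close> inside a chord is not interior, no point \<open>p\<close>
  of the chord is: the open segment from an interior \<open>p\<close> to the end point beyond
  \<open>?z\<close> would be interior and contain \<open>?z\<close>. The whole chord then lies in
  the boundary.\<close>

lemma strictly_convex_body_imp_strict_body:
  assumes "strictly_convex_body C"
  shows "strict_body C"
proof
  show C: "convex C" "compact C" "interior C \<noteq> {}" using assms by (auto simp: strictly_convex_body_def convex_body_def)
  fix x y and t :: real
  assume xy: "x \<in> C" "y \<in> C" "x \<noteq> y" and t: "0 < t" "t < 1"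
  let ?z = "(1 - t) *\<^sub>R x + t *\<^sub>R y"
  show "?z \<in> interior C"
  proof (rule ccontr)
    assume z: "?z \<notin> interior C"
    have "p \<notin> interior C" if p: "p \<in> closed_segment x y" for p
    proof
      assume pi: "p \<in> interior C"
      obtain s where s: "p = (1 - s) *\<^sub>R x + s *\<^sub>R y" "0 \<le> s" "s \<le> 1" using p by (auto simp: in_segment)
      have sub: "open_segment p q \<subseteq> interior C" if "q \<in> C" for q
        using in_interior_closure_convex_segment[OF C(1) pi, of q] that closure_subset by blast
      consider "s = t" | "s < t" | "t < s" by linarith
      then show False
      proof cases
        case 1
        then show False using pi s z by simp
      next
        case 2
        define k where "k = (t - s) / (1 - s)"
        have k: "0 < k" "k < 1" using 2 t by (auto simp: k_def)
        have "k * (1 - s) = t - s" using 2 t by (simp add: k_def)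
        then have "(1 - k) * (1 - s) = 1 - t" "(1 - k) * s + k = t" by algebra+
        then have "?z = (1 - k) *\<^sub>R p + k *\<^sub>R y"
          by (simp add: s(1) scaleR_add_right add.assoc flip: scaleR_add_left)
        moreover have "p \<noteq> y" using s xy 2 t
          by (metis \<open>p \<in> interior C\<close> k calculation z scaleR_collapse)
        ultimately have "?z \<in> open_segment p y" using k by (auto simp: in_segment)
        then show False using sub xy z by blast
      next
        case 3
        define k where "k = (s - t) / s"
        have k: "0 < k" "k < 1" using 3 t by (auto simp: k_def field_simps)
        have "k * s = s - t" using 3 t by (simp add: k_def)
        then have "(1 - k) * s = t" "(1 - k) * (1 - s) + k = 1 - t" by algebra+
        then have "?z = (1 - k) *\<^sub>R p + k *\<^sub>R x"
          by (simp add: s(1) scaleR_add_right add.assoc add.commute add.left_commute flip: scaleR_add_left)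
        moreover have "p \<noteq> x"
          by (metis \<open>p \<in> interior C\<close> calculation z scaleR_collapse)
        ultimately have "?z \<in> open_segment p x" using k by (auto simp: in_segment)
        then show False using sub xy z by blast
      qed
    qed
    moreover have "closed_segment x y \<subseteq> C" using closed_segment_subset[OF xy(1,2) C(1)] .
    ultimately have "closed_segment x y \<subseteq> frontier C"
      using closure_subset[of C] by (auto simp: frontier_def)
    then show False using assms xy(3) by (auto simp: strictly_convex_body_def)
  qed
qed

lemma is_homothet_of_iff:
  "is_homothet_of C H \<longleftrightarrow> (\<exists>l y. l > 0 \<and> H = {x. l *\<^sub>R x + y \<in> C})"
proof
  assume "is_homothet_of C H"
  then obtain l x where l: "l > 0" "H = homothet C l x" by (auto simp: is_homothet_of_def)
  have "H = {p. (1 / l) *\<^sub>R p + - (1 / l) *\<^sub>R x \<in> C}"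
  proof (intro set_eqI iffI)
    fix p assume "p \<in> H"
    then show "p \<in> {p. (1 / l) *\<^sub>R p + - (1 / l) *\<^sub>R x \<in> C}" using l by (auto simp: homothet_def algebra_simps)
  next
    fix p assume p: "p \<in> {p. (1 / l) *\<^sub>R p + - (1 / l) *\<^sub>R x \<in> C}"
    have "p = l *\<^sub>R ((1 / l) *\<^sub>R p + - (1 / l) *\<^sub>R x) + x" using l by (simp add: algebra_simps)
    then show "p \<in> H" using p l unfolding homothet_def by blast
  qed
  then show "\<exists>l y. l > 0 \<and> H = {x. l *\<^sub>R x + y \<in> C}" using l(1) by (metis zero_less_divide_1_iff)
next
  assume "\<exists>l y. l > 0 \<and> H = {x. l *\<^sub>R x + y \<in> C}"
  then obtain l y where l: "l > 0" "H = {x. l *\<^sub>R x + y \<in> C}" by blast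
  have "H = homothet C (1 / l) (- (1 / l) *\<^sub>R y)"
  proof (intro set_eqI iffI)
    fix p assume "p \<in> H"
    moreover have "p = (1 / l) *\<^sub>R (l *\<^sub>R p + y) + - (1 / l) *\<^sub>R y" using l by (simp add: algebra_simps)
    ultimately show "p \<in> homothet C (1 / l) (- (1 / l) *\<^sub>R y)" unfolding homothet_def l(2) by blast
  next
    fix p assume "p \<in> homothet C (1 / l) (- (1 / l) *\<^sub>R y)"
    then show "p \<in> H" using l by (auto simp: homothet_def algebra_simps)
  qed
  then show "is_homothet_of C H" using l(1) unfolding is_homothet_of_def by (metis zero_less_divide_1_iff)
qed

context strict_body
begin

lemma singleton_homothet:
  assumes "finite S" "x \<in> S"
  shows "\<exists>H. is_homothet_of C H \<and> H \<inter> S = {x}"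
proof -
  obtain y0 where y0: "y0 \<in> C" using int_ne int_C by blast
  obtain B where B: "\<And>x. x \<in> C \<Longrightarrow> norm x \<le> B" using compact_imp_bounded[OF compactC] by (auto simp: bounded_iff)
  obtain \<delta> where \<delta>: "\<delta> > 0" "\<forall>z\<in>S. z \<noteq> x \<longrightarrow> \<delta> \<le> dist x z" using finite_set_avoid[OF assms(1)] by blast
  have B0: "0 \<le> B" using B[OF y0] norm_ge_zero order_trans by blast
  \<comment> \<open>The diameter of \<open>C\<close> is at most \<open>2 * B\<close>, so after
    division by this \<open>l\<close> it is smaller than the least distance \<open>\<delta>\<close>
    from \<open>x\<close> to the rest of \<open>S\<close>.\<close>
  define l where "l = (2 * B + 1) / \<delta>"
  have l: "l > 0" using \<delta> B0 by (simp add: l_def)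
  let ?H = "{z. l *\<^sub>R z + (y0 - l *\<^sub>R x) \<in> C}"
  have "z = x" if z: "z \<in> S" "z \<in> ?H" for z
  proof (rule ccontr)
    assume "z \<noteq> x"
    then have d: "\<delta> \<le> norm (z - x)" using \<delta> z by (metis dist_norm norm_minus_commute)
    have "norm (l *\<^sub>R (z - x)) = norm ((l *\<^sub>R z + (y0 - l *\<^sub>R x)) - y0)" by (simp add: algebra_simps)
    also have "\<dots> \<le> norm (l *\<^sub>R z + (y0 - l *\<^sub>R x)) + norm y0" by (rule norm_triangle_ineq4)
    also have "\<dots> \<le> B + B" using B[OF y0] B z(2) by (intro add_mono) auto
    finally have "l * norm (z - x) \<le> 2 * B" using l by simp
    moreover have "l * \<delta> \<le> l * norm (z - x)" using l d by simp
    moreover have "l * \<delta> = 2 * B + 1" using \<delta> by (simp add: l_def)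
    ultimately show False by linarith
  qed
  then have "?H \<inter> S = {x}" using assms y0 by auto
  then show ?thesis using l is_homothet_of_iff by blast
qed

text \<open>One homothet per matching edge and one per unmatched point cover \<open>S\<close>, which
  uses at most \<open>card M + (card S - 2 * card M)\<close> homothets.\<close>

lemma f_cover_le_matching:
  assumes S: "finite S" and E: "\<And>e. e \<in> E \<Longrightarrow> card e = 2 \<and> (\<exists>H. is_homothet_of C H \<and> H \<inter> S = e)"
    and M: "matching E M"
  shows "f_cover C 2 S + card M \<le> card S"
proof -
  have ME: "M \<subseteq> E" using M by (simp add: matching_def)
  have MS: "\<Union>M \<subseteq> S" using ME E by blast
  have "M \<subseteq> Pow S" using MS by blast
  then have finM: "finite M" using S by (simp add: finite_subset)
  define P where "P = M \<union> (\<lambda>x. {x}) ` (S - \<Union>M)"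
  have "\<forall>e\<in>P. \<exists>H. is_homothet_of C H \<and> H \<inter> S = e"
    using E ME singleton_homothet[OF S] by (auto simp: P_def)
  then obtain h where h: "\<And>e. e \<in> P \<Longrightarrow> is_homothet_of C (h e)" "\<And>e. e \<in> P \<Longrightarrow> h e \<inter> S = e" by metis
  have c2: "card e \<le> 2" if "e \<in> P" for e using that E ME by (auto simp: P_def)
  have finP: "finite P" using finM S by (simp add: P_def)
  have "S \<subseteq> \<Union>P" by (auto simp: P_def)
  then have "S \<subseteq> \<Union>(h ` P)" using h(2) by blast
  then have ex: "\<exists>F. finite F \<and> card F = card (h ` P) \<and>
      (\<forall>H\<in>F. is_homothet_of C H \<and> card (H \<inter> S) \<le> 2) \<and> S \<subseteq> \<Union>F"
    using finP h c2 by (intro exI[of _ "h ` P"]) auto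
  have "f_cover C 2 S \<le> card (h ` P)" unfolding f_cover_def by (rule Least_le) (rule ex)
  also have "\<dots> \<le> card P" by (rule card_image_le[OF finP])
  also have "\<dots> \<le> card M + card ((\<lambda>x. {x}) ` (S - \<Union>M))" unfolding P_def by (rule card_Un_le)
  also have "\<dots> \<le> card M + card (S - \<Union>M)" using S by (simp add: card_image_le)
  also have "card (S - \<Union>M) = card S - 2 * card M"
    using matching_Union_card[OF M finM] E MS S by (simp add: card_Diff_subset finite_subset)
  finally have "f_cover C 2 S \<le> card M + (card S - 2 * card M)" .
  moreover have "2 * card M \<le> card S"
    using matching_Union_card[OF M finM] E card_mono[OF S MS] by simp
  ultimately show ?thesis by linarith
qed

end

theorem mainTheorem13:
  fixes C S :: "(real^2) set"
  assumes "strictly_convex_body C"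
    and "finite S"
  shows "int (f_cover C 2 S) \<le> int (card S) - \<lceil>(real (card S) - 8) / 3\<rceil>"
proof -
  interpret strict_body C by (rule strictly_convex_body_imp_strict_body[OF assms(1)])
  define E where "E = {e. card e = 2 \<and> (\<exists>H. is_homothet_of C H \<and> H \<inter> S = e)}"
  have "\<And>e. e \<in> E \<Longrightarrow> e \<subseteq> S \<and> card e = 2" by (auto simp: E_def)
  then obtain M T W where M: "matching E M" and T: "T \<subseteq> S" and W: "W \<subseteq> S - T" and TM: "card T \<le> card M"
    and eq: "card W + 2 * card M = card S + card T"
    and sep: "\<forall>w\<in>W. \<forall>w'\<in>W. w \<noteq> w' \<longrightarrow> (\<exists>A \<subseteq> S - T. w \<in> A \<and> w' \<notin> A \<and>
        (\<forall>x\<in>A. \<forall>y\<in>S - T - A. {x, y} \<notin> E))"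
    using gallai_separation[OF assms(2), of E] by (elim exE conjE meta_impE) (assumption | rule that)+
  have "card W \<le> 2 * card T + 8"
  proof (rule card_separated_by_empty_homothets)
    show "finite T" "finite W" "W \<inter> T = {}" using T W assms(2) by (auto intro: finite_subset)
    fix l y w w' assume D: "l > 0" "w \<in> W" "w' \<in> W" "w \<noteq> w'" "l *\<^sub>R w + y \<in> C" "l *\<^sub>R w' + y \<in> C"
    show "\<exists>z\<in>T. l *\<^sub>R z + y \<in> C"
    proof (rule ccontr)
      assume no: "\<not> (\<exists>z\<in>T. l *\<^sub>R z + y \<in> C)"
      obtain A where A: "A \<subseteq> S - T" "w \<in> A" "w' \<notin> A" "\<forall>x\<in>A. \<forall>y\<in>S - T - A. {x, y} \<notin> E"
        using sep D by meson
      \<comment> \<open>A homothet that avoids \<open>T\<close> but contains points on both sides of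
        the cut \<open>A\<close> would produce an edge across the cut.\<close>
      have "\<exists>l y p q. l > 0 \<and> p \<in> A \<and> q \<in> S - T - A \<and> {x \<in> S. l *\<^sub>R x + y \<in> C} = {p, q}"
        by (rule edge_between[OF assms(2) _ D(1), of A "S - T - A" y w w']) (use no A D W in auto)
      then obtain l' y' p q where pq: "l' > 0" "p \<in> A" "q \<in> S - T - A" "{x \<in> S. l' *\<^sub>R x + y' \<in> C} = {p, q}" by blast
      have "is_homothet_of C {x. l' *\<^sub>R x + y' \<in> C}" using pq(1) is_homothet_of_iff by blast
      moreover have "{x. l' *\<^sub>R x + y' \<in> C} \<inter> S = {p, q}" using pq(4) by blast
      moreover have "p \<noteq> q" using pq(2,3) by blast
      then have "card {p, q} = 2" by simp
      ultimately have "{p, q} \<in> E" unfolding E_def by blast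
      then show False using A pq by blast
    qed
  qed
  \<comment> \<open>From \<open>eq\<close> and the bound on \<open>W\<close>, \<open>card S\<close>
    is at most \<open>2 * card M + card T + 8\<close>, and \<open>card T \<le> card M\<close>
    finishes the count.\<close>
  then have n: "card S \<le> 3 * card M + 8" using eq TM by linarith
  have "f_cover C 2 S + card M \<le> card S"
    by (rule f_cover_le_matching[OF assms(2) _ M]) (simp add: E_def)
  moreover have "\<lceil>(real (card S) - 8) / 3\<rceil> \<le> int (card M)"
    using n by (simp add: ceiling_le_iff)
  ultimately show ?thesis by linarith
qed

end
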